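(* The algebraic variety of flexes of plane cubics $$X=\{a\in\mathbb P(U)\times\mathbb P(V)\mid F(a)=H(a)=0\}$$ is rational.
   Context: Everything is over $\mathbb C$. $V=\mathbb C^3$ with standard coordinate functions $x_0,x_1,x_2\in V^*$; $U={\sf S}^3(V^* )$ is the $10$-dimensional vector space of degree $3$ forms on $V$, with basis the monomials $x_0^{i_0}x_1^{i_1}x_2^{i_2}$, $i_0+i_1+i_2=3$, and $\{\alpha_{i_0i_1i_2}\}$ is the dual basis of $U^*$. $\mathbb P(V)$, $\mathbb P(U)$ are the projective spaces of one-dimensional linear subspaces. On $\mathbb P(U)\times\mathbb P(V)$ consider the (bihomogeneous) forms $$F=\sum_{i_0+i_1+i_2=3}\alpha_{i_0i_1i_2}x_0^{i_0}x_1^{i_1}x_2^{i_2},\qquad H=\det\Big(\frac{\partial^2F}{\partial x_i\partial x_j}\Big)_{0\le i,j\le 2}.$$ $X$ is regarded as an algebraic variety (closed subset of $\mathbb P(U)\times\mathbb P(V)$ with its reduced structure). An irreducible variety is rational if it is birationally isomorphic to a projective space. *)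

theory Defs
  imports "HOL-Analysis.Analysis" "HOL-Library.Poly_Mapping"
begin

(* Polynomials: \<open>('i \<Rightarrow>\<^sub>0 nat) \<Rightarrow>\<^sub>0 complex\<close> is the polynomial ring over the complex numbers in
   indeterminates indexed by 'i; the exponents of a monomial form an element of
   \<open>'i \<Rightarrow>\<^sub>0 nat\<close>. *)

type_synonym 'i cpoly = "('i \<Rightarrow>\<^sub>0 nat) \<Rightarrow>\<^sub>0 complex"

definition indet :: "'i \<Rightarrow> 'i cpoly" where
  "indet i = Poly_Mapping.single (Poly_Mapping.single i 1) 1"

definition eval_poly :: "('i \<Rightarrow> complex) \<Rightarrow> 'i cpoly \<Rightarrow> complex" where
  "eval_poly v P =
     (\<Sum>m\<in>Poly_Mapping.keys P. Poly_Mapping.lookup P m *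
        (\<Prod>i\<in>Poly_Mapping.keys m. v i ^ Poly_Mapping.lookup m i))"

(* The formal partial derivative with respect to the indeterminate i. The truncated subtraction
   is harmless: where i does not occur in m, the coefficient is 0. *)
definition partial_deriv :: "'i \<Rightarrow> 'i cpoly \<Rightarrow> 'i cpoly" where
  "partial_deriv i P =
     (\<Sum>m\<in>Poly_Mapping.keys P.
        Poly_Mapping.single (m - Poly_Mapping.single i 1)
          (Poly_Mapping.lookup P m * of_nat (Poly_Mapping.lookup m i)))"

definition mono_degree :: "('i \<Rightarrow>\<^sub>0 nat) \<Rightarrow> nat" where
  "mono_degree m = (\<Sum>i\<in>Poly_Mapping.keys m. Poly_Mapping.lookup m i)"

definition homogeneous_polys :: "nat \<Rightarrow> 'i cpoly set" where
  "homogeneous_polys d = {P. \<forall>m\<in>Poly_Mapping.keys P. mono_degree m = d}"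

definition bihomogeneous_polys :: "nat \<times> nat \<Rightarrow> ('i + 'j) cpoly set" where
  "bihomogeneous_polys = (\<lambda>(d, e). {P. \<forall>m\<in>Poly_Mapping.keys P.
     (\<Sum>k\<in>{k \<in> Poly_Mapping.keys m. isl k}. Poly_Mapping.lookup m k) = d \<and>
     (\<Sum>k\<in>{k \<in> Poly_Mapping.keys m. \<not> isl k}. Poly_Mapping.lookup m k) = e})"


(* Varieties are treated as spaces with functions: a (Zariski) topology together with, for
   every open set W, the complex functions that are regular on W. Only the values on W of a
   function matter for its being regular on W. *)

record 'p fun_space =
  zariski :: "'p topology"
  regular_on :: "'p set \<Rightarrow> ('p \<Rightarrow> complex) \<Rightarrow> bool"

abbreviation points :: "'p fun_space \<Rightarrow> 'p set" where
  "points X \<equiv> topspace (zariski X)"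

(* The structure given by homogeneous coordinates: coords a is the set of all coordinate vectors
   of the point a, and D d is the set of forms of (multi)degree d. The topology is generated by
   the principal open sets, and the regular functions are those that are locally quotients of
   forms of equal degree. *)
definition coordinate_space ::
  "'p set \<Rightarrow> ('p \<Rightarrow> ('i \<Rightarrow> complex) set) \<Rightarrow> ('d \<Rightarrow> 'i cpoly set) \<Rightarrow> 'p fun_space" where
  "coordinate_space A coords D =
     (let T = topology_generated_by
                {{a \<in> A. \<forall>v\<in>coords a. eval_poly v P \<noteq> 0} | P d. P \<in> D d}
      in \<lparr> zariski = T,
           regular_on = (\<lambda>W f. openin T W \<and>
             (\<forall>a\<in>W. \<exists>N d G H. openin T N \<and> a \<in> N \<and> N \<subseteq> W \<and> G \<in> D d \<and> H \<in> D d \<and>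
                (\<forall>b\<in>N. \<forall>v\<in>coords b. eval_poly v H \<noteq> 0 \<and>
                   f b = eval_poly v G / eval_poly v H))) \<rparr>)"

(* For closed A this is the closed subvariety A with its reduced structure. *)
definition subspace_on :: "'p fun_space \<Rightarrow> 'p set \<Rightarrow> 'p fun_space" where
  "subspace_on X A =
     \<lparr> zariski = subtopology (zariski X) A,
       regular_on = (\<lambda>W f. openin (subtopology (zariski X) A) W \<and>
         (\<forall>a\<in>W. \<exists>N g. openin (zariski X) N \<and> a \<in> N \<and> regular_on X N g \<and>
            (\<forall>b\<in>N \<inter> W. f b = g b))) \<rparr>"

definition morphism :: "'p fun_space \<Rightarrow> 'q fun_space \<Rightarrow> ('p \<Rightarrow> 'q) \<Rightarrow> bool" where
  "morphism X Y f \<longleftrightarrow>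
     continuous_map (zariski X) (zariski Y) f \<and>
     (\<forall>W g. regular_on Y W g \<longrightarrow> regular_on X {x \<in> points X. f x \<in> W} (g \<circ> f))"

definition irreducible_variety :: "'p fun_space \<Rightarrow> bool" where
  "irreducible_variety X \<longleftrightarrow> points X \<noteq> {} \<and>
     (\<forall>C D. closedin (zariski X) C \<and> closedin (zariski X) D \<and> C \<union> D = points X \<longrightarrow>
        C = points X \<or> D = points X)"

(* The pair of W and f represents a dominant rational map from X to Y. *)
definition dominant_rational_map ::
  "'p fun_space \<Rightarrow> 'q fun_space \<Rightarrow> 'p set \<Rightarrow> ('p \<Rightarrow> 'q) \<Rightarrow> bool" where
  "dominant_rational_map X Y W f \<longleftrightarrow>
     openin (zariski X) W \<and> W \<noteq> {} \<and> morphism (subspace_on X W) Y f \<and>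
     zariski Y closure_of (f ` W) = points Y"

(* For irreducible X and Y: rational maps in both directions whose composites are, as rational
   maps, the identities, i.e. agree with them on a nonempty open set. *)
definition birationally_isomorphic :: "'p fun_space \<Rightarrow> 'q fun_space \<Rightarrow> bool" where
  "birationally_isomorphic X Y \<longleftrightarrow>
     (\<exists>W f W' g. dominant_rational_map X Y W f \<and> dominant_rational_map Y X W' g \<and>
        (\<exists>N. openin (zariski X) N \<and> N \<noteq> {} \<and>
           (\<forall>x\<in>N. x \<in> W \<and> f x \<in> W' \<and> g (f x) = x)) \<and>
        (\<exists>N. openin (zariski Y) N \<and> N \<noteq> {} \<and>
           (\<forall>y\<in>N. y \<in> W' \<and> g y \<in> W \<and> f (g y) = y)))"


(* Vectors with coordinates indexed by 'i are elements of \<open>'i \<Rightarrow>\<^sub>0 complex\<close>, and I is the set of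
   coordinates that need not vanish. *)

definition scale_vec :: "complex \<Rightarrow> ('i \<Rightarrow>\<^sub>0 complex) \<Rightarrow> ('i \<Rightarrow>\<^sub>0 complex)" where
  "scale_vec c v = Poly_Mapping.map ((*) c) v"

definition lines :: "'i set \<Rightarrow> ('i \<Rightarrow>\<^sub>0 complex) set set" where
  "lines I = {range (\<lambda>c. scale_vec c v) | v. v \<noteq> 0 \<and> Poly_Mapping.keys v \<subseteq> I}"

definition line_coords :: "('i \<Rightarrow>\<^sub>0 complex) set \<Rightarrow> ('i \<Rightarrow> complex) set" where
  "line_coords L = {Poly_Mapping.lookup v | v. v \<in> L \<and> v \<noteq> 0}"

definition projectivization :: "'i set \<Rightarrow> ('i \<Rightarrow>\<^sub>0 complex) set fun_space" where
  "projectivization I = coordinate_space (lines I) line_coords homogeneous_polys"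

definition projective_space :: "nat \<Rightarrow> (nat \<Rightarrow>\<^sub>0 complex) set fun_space" where
  "projective_space n = projectivization {..n}"

definition pair_coords ::
  "('i \<Rightarrow>\<^sub>0 complex) set \<times> ('j \<Rightarrow>\<^sub>0 complex) set \<Rightarrow> ('i + 'j \<Rightarrow> complex) set" where
  "pair_coords = (\<lambda>(L, M). {case_sum u v | u v. u \<in> line_coords L \<and> v \<in> line_coords M})"

definition biprojectivization ::
  "'i set \<Rightarrow> 'j set \<Rightarrow> (('i \<Rightarrow>\<^sub>0 complex) set \<times> ('j \<Rightarrow>\<^sub>0 complex) set) fun_space" where
  "biprojectivization I J =
     coordinate_space (lines I \<times> lines J) pair_coords bihomogeneous_polys"

definition rational_variety :: "'p fun_space \<Rightarrow> bool" where
  "rational_variety X \<longleftrightarrow>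
     irreducible_variety X \<and> (\<exists>n. birationally_isomorphic X (projective_space n))"


(* V is \<open>3 \<Rightarrow>\<^sub>0 complex\<close>, with indices 0, 1, 2 of the three-element type 3. The vectors with
   coordinates indexed by cubic_exponents are literally the cubic forms in
   \<open>(3 \<Rightarrow>\<^sub>0 nat) \<Rightarrow>\<^sub>0 complex\<close>, and their coordinates are their coefficients. *)

definition cubic_exponents :: "(3 \<Rightarrow>\<^sub>0 nat) set" where
  "cubic_exponents = {e. mono_degree e = 3}"

abbreviation \<alpha>_var :: "(3 \<Rightarrow>\<^sub>0 nat) \<Rightarrow> ((3 \<Rightarrow>\<^sub>0 nat) + 3) cpoly" where
  "\<alpha>_var e \<equiv> indet (Inl e)"

abbreviation x_var :: "3 \<Rightarrow> ((3 \<Rightarrow>\<^sub>0 nat) + 3) cpoly" where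
  "x_var i \<equiv> indet (Inr i)"

definition F_form :: "((3 \<Rightarrow>\<^sub>0 nat) + 3) cpoly" where
  "F_form = (\<Sum>e\<in>cubic_exponents. \<alpha>_var e * (\<Prod>i\<in>UNIV. x_var i ^ Poly_Mapping.lookup e i))"

definition H_form :: "((3 \<Rightarrow>\<^sub>0 nat) + 3) cpoly" where
  "H_form = det (\<chi> i j. partial_deriv (Inr i) (partial_deriv (Inr j) F_form))"

definition PU_times_PV ::
  "(((3 \<Rightarrow>\<^sub>0 nat) \<Rightarrow>\<^sub>0 complex) set \<times> (3 \<Rightarrow>\<^sub>0 complex) set) fun_space" where
  "PU_times_PV = biprojectivization cubic_exponents UNIV"

definition flex_locus ::
  "(((3 \<Rightarrow>\<^sub>0 nat) \<Rightarrow>\<^sub>0 complex) set \<times> (3 \<Rightarrow>\<^sub>0 complex) set) set" where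
  "flex_locus = {a \<in> points PU_times_PV.
     \<forall>v\<in>pair_coords a. eval_poly v F_form = 0 \<and> eval_poly v H_form = 0}"

definition flex_variety ::
  "(((3 \<Rightarrow>\<^sub>0 nat) \<Rightarrow>\<^sub>0 complex) set \<times> (3 \<Rightarrow>\<^sub>0 complex) set) fun_space" where
  "flex_variety = subspace_on PU_times_PV flex_locus"

end

theory Submission
  imports Defs
begin

text \<open>
  Fix a point \<open>p\<close> with \<open>p\<^sub>0 = 1\<close> and let \<open>y\<^sub>1 = x\<^sub>1 - p\<^sub>1 x\<^sub>0\<close>, \<open>y\<^sub>2 = x\<^sub>2 - p\<^sub>2 x\<^sub>0\<close>. A cubic form vanishing
  at \<open>p\<close> is \<open>x\<^sub>0\<^sup>2 A + x\<^sub>0 Q + C\<close> with binary forms \<open>A\<close>, \<open>Q\<close>, \<open>C\<close> of degrees 1, 2, 3 in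
  \<open>y\<^sub>1, y\<^sub>2\<close>. By Euler's relations the Hessian at \<open>p\<close> is, up to a nonzero constant factor, the value of
  \<open>Q\<close> at the zero \<open>(b, - a)\<close> of \<open>A = a y\<^sub>1 + b y\<^sub>2\<close> (\<open>hessian_at_zero\<close>). So \<open>p\<close> is a flex exactly if \<open>A = t l\<close> and
  \<open>Q = l M\<close> for some linear forms \<open>l\<close>, \<open>M\<close> in \<open>y\<^sub>1, y\<^sub>2\<close> and a constant \<open>t\<close>
  (\<open>tangent_conic_split\<close>), that is, if the cubic is \<open>l x\<^sub>0 (t x\<^sub>0 + M) + C\<close> (\<open>local_form\<close>).
  Points with \<open>p\<^sub>0 = 0\<close> are brought to this position by permuting the coordinates.

  This description gives both halves of rationality.

  \<^item> Irreducibility. Without reference to coordinates, the cubics with a flex at \<open>p\<close> are the cubics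
    \<open>l q + m n\<^sup>2 + m' n'\<^sup>2\<close> with a quadratic form \<open>q\<close> and linear forms \<open>l, m, n, m', n'\<close> that
    vanish at \<open>p\<close>, and the latter are the forms \<open>x \<mapsto> det (p, u, x)\<close>. So all flexes arise from
    one polynomial map on a space of parameters. The segment between two
    parameters gives a polynomial curve in the flex variety between any two of its points
    (\<open>hyperconnected_flex_variety\<close>), and a set whose points are joined by such curves is
    irreducible (\<open>hyperconnected_by_curves\<close>).

  \<^item> Birationality with the projective space of dimension 9. Where \<open>\<partial>F/\<partial>x\<^sub>1\<close> does not vanish at \<open>p\<close>, the form \<open>A\<close> can be
    normalized to \<open>y\<^sub>1 + b y\<^sub>2\<close>, so that \<open>t = 1\<close>, \<open>l = A\<close>. The nine numbers consisting of \<open>p\<^sub>1\<close>,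
    \<open>p\<^sub>2\<close>, \<open>b\<close>, the two coefficients of \<open>M\<close> and the four coefficients of \<open>C\<close> then are affine
    coordinates of the flex, without any relation between them. They are read off from
    derivatives at \<open>p\<close> and so are rational functions; conversely, the coefficients of the cubic
    are polynomials in them. Homogenizing gives \<open>chart_params\<close> and \<open>chart_coeffs\<close>, and with them
    mutually inverse morphisms between a nonempty open set of flexes and the open set
    \<open>z\<^sub>0 \<noteq> 0\<close> of the projective space. Since both varieties are irreducible, these sets are dense.
\<close>

abbreviation lookup where "lookup \<equiv> Poly_Mapping.lookup"
abbreviation keys where "keys \<equiv> Poly_Mapping.keys"
abbreviation single where "single \<equiv> Poly_Mapping.single"

section \<open>Evaluation of polynomials\<close>

definition eval_mono :: "('i \<Rightarrow> complex) \<Rightarrow> ('i \<Rightarrow>\<^sub>0 nat) \<Rightarrow> complex" where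
  "eval_mono v m = (\<Prod>i\<in>keys m. v i ^ lookup m i)"

lemma eval_mono_superset:
  assumes "finite K" "keys m \<subseteq> K"
  shows "eval_mono v m = (\<Prod>i\<in>K. v i ^ lookup m i)"
  unfolding eval_mono_def
  by (rule prod.mono_neutral_left) (use assms in \<open>auto simp: in_keys_iff\<close>)

lemma eval_mono_0 [simp]: "eval_mono v 0 = 1"
  by (simp add: eval_mono_def)

lemma eval_mono_single [simp]: "eval_mono v (single i n) = v i ^ n"
  by (simp add: eval_mono_def)

lemma eval_mono_add: "eval_mono v (m + n) = eval_mono v m * eval_mono v n"
proof -
  let ?K = "keys m \<union> keys n"
  have "eval_mono v k = (\<Prod>i\<in>?K. v i ^ lookup k i)" if "keys k \<subseteq> ?K" for k
    using that by (intro eval_mono_superset) auto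
  then show ?thesis
    using keys_add[of m n] by (simp add: lookup_add power_add prod.distrib)
qed

lemma eval_poly_superset:
  assumes "finite K" "keys P \<subseteq> K"
  shows "eval_poly v P = (\<Sum>m\<in>K. lookup P m * eval_mono v m)"
  unfolding eval_poly_def eval_mono_def[symmetric]
  by (rule sum.mono_neutral_left) (use assms in \<open>auto simp: in_keys_iff\<close>)

lemma eval_poly_0 [simp]: "eval_poly v 0 = 0"
  by (simp add: eval_poly_def)

lemma eval_poly_single [simp]: "eval_poly v (single m c) = c * eval_mono v m"
  by (simp add: eval_poly_def eval_mono_def)

lemma eval_poly_add: "eval_poly v (P + Q) = eval_poly v P + eval_poly v Q"
proof -
  let ?K = "keys P \<union> keys Q"
  have "eval_poly v R = (\<Sum>m\<in>?K. lookup R m * eval_mono v m)" if "keys R \<subseteq> ?K" for R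
    using that by (intro eval_poly_superset) auto
  then show ?thesis
    using keys_add[of P Q] by (simp add: lookup_add distrib_right sum.distrib)
qed

lemma eval_poly_sum: "eval_poly v (sum P A) = (\<Sum>a\<in>A. eval_poly v (P a))"
  by (induction A rule: infinite_finite_induct) (auto simp: eval_poly_add)

lemma sum_single_lookup: "(\<Sum>m\<in>keys P. single m (lookup P m)) = P"
  by (rule poly_mapping_eqI)
     (auto simp: lookup_sum lookup_single when_def in_keys_iff)

lemma eval_poly_mult: "eval_poly v (P * Q) = eval_poly v P * eval_poly v Q"
proof -
  have "P * Q = (\<Sum>m\<in>keys P. \<Sum>n\<in>keys Q. single (m + n) (lookup P m * lookup Q n))"
    by (subst sum_single_lookup[of P, symmetric], subst sum_single_lookup[of Q, symmetric])
       (simp add: sum_product mult_single)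
  then show ?thesis
    by (simp add: eval_poly_sum eval_mono_add)
       (simp add: eval_poly_def eval_mono_def[symmetric] sum_product mult_ac)
qed

lemma eval_poly_uminus: "eval_poly v (- P) = - eval_poly v P"
  using eval_poly_add[of v P "- P"] by (simp add: eq_neg_iff_add_eq_0 add.commute)

lemma eval_poly_diff: "eval_poly v (P - Q) = eval_poly v P - eval_poly v Q"
  using eval_poly_add[of v P "- Q"] by (simp add: eval_poly_uminus)

lemma eval_poly_1 [simp]: "eval_poly v 1 = 1"
  using eval_poly_single[of v 0 1] by (simp del: eval_poly_single)


section \<open>Forms\<close>

text \<open>The degree of forms and the bidegree of bihomogeneous forms are both additive on monomials,
  and this is all that the geometry below uses. Forms are handled through the functions they
  induce, so that they can be substituted into each other without a substitution operation on
  polynomials.\<close>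

locale graded_polys =
  fixes mdeg :: "('i \<Rightarrow>\<^sub>0 nat) \<Rightarrow> 'd::comm_monoid_add"
  assumes mdeg_0 [simp]: "mdeg 0 = 0"
    and mdeg_add: "mdeg (m + n) = mdeg m + mdeg n"
begin

definition forms :: "'d \<Rightarrow> 'i cpoly set" where
  "forms d = {P. \<forall>m\<in>keys P. mdeg m = d}"

definition is_form :: "'d \<Rightarrow> (('i \<Rightarrow> complex) \<Rightarrow> complex) \<Rightarrow> bool" where
  "is_form d h \<longleftrightarrow> (\<exists>P\<in>forms d. \<forall>v. h v = eval_poly v P)"

lemma is_formI: "P \<in> forms d \<Longrightarrow> (\<And>v. h v = eval_poly v P) \<Longrightarrow> is_form d h"
  by (auto simp: is_form_def)

lemma mult_in_forms: "P \<in> forms d \<Longrightarrow> Q \<in> forms e \<Longrightarrow> P * Q \<in> forms (d + e)"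
  using keys_mult[of P Q] by (force simp: forms_def mdeg_add)

lemma one_in_forms: "1 \<in> forms 0"
  by (simp add: forms_def)

lemma is_form_0: "is_form d (\<lambda>v. 0)"
  by (rule is_formI[of 0]) (auto simp: forms_def)

lemma is_form_const: "is_form 0 (\<lambda>v. c)"
  by (rule is_formI[of "single 0 c"]) (auto simp: forms_def)

lemma is_form_var: "mdeg (single i 1) = d \<Longrightarrow> is_form d (\<lambda>v. v i)"
  by (rule is_formI[of "indet i"]) (auto simp: forms_def indet_def)

lemma is_form_add:
  assumes "is_form d g" "is_form d h"
  shows "is_form d (\<lambda>v. g v + h v)"
proof -
  obtain P Q where "P \<in> forms d" "Q \<in> forms d" "\<And>v. g v = eval_poly v P" "\<And>v. h v = eval_poly v Q"
    using assms by (auto simp: is_form_def)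
  then show ?thesis
    using keys_add[of P Q] by (intro is_formI[of "P + Q"]) (auto simp: eval_poly_add forms_def)
qed

lemma is_form_mult:
  assumes "is_form d g" "is_form e h" "k = d + e"
  shows "is_form k (\<lambda>v. g v * h v)"
proof -
  obtain P Q where "P \<in> forms d" "Q \<in> forms e" "\<And>v. g v = eval_poly v P" "\<And>v. h v = eval_poly v Q"
    using assms by (auto simp: is_form_def)
  then show ?thesis
    using mult_in_forms[of P d Q e] assms(3) by (intro is_formI[of "P * Q"]) (auto simp: eval_poly_mult)
qed

lemma is_form_cmult: "is_form d h \<Longrightarrow> is_form d (\<lambda>v. c * h v)"
  by (rule is_form_mult[OF is_form_const]) auto

lemma is_form_uminus: "is_form d h \<Longrightarrow> is_form d (\<lambda>v. - h v)"
  using is_form_cmult[of d h "-1"] by simp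

lemma is_form_diff: "is_form d g \<Longrightarrow> is_form d h \<Longrightarrow> is_form d (\<lambda>v. g v - h v)"
  using is_form_add[of d g "\<lambda>v. - h v"] is_form_uminus by simp

lemma is_form_sum: "(\<And>a. a \<in> A \<Longrightarrow> is_form d (h a)) \<Longrightarrow> is_form d (\<lambda>v. \<Sum>a\<in>A. h a v)"
  by (induction A rule: infinite_finite_induct) (auto intro: is_form_0 is_form_add)

end

lemma poly_mapping_nat_induct [case_names zero add]:
  fixes m :: "'i \<Rightarrow>\<^sub>0 nat"
  assumes "P 0" and add: "\<And>i m. P m \<Longrightarrow> P (single i 1 + m)"
  shows "P m"
proof -
  have step: "P (single i n + m)" if "P m" for i n m
  proof (induction n)
    case (Suc n)
    have "single i (Suc n) + m = single i 1 + (single i n + m)"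
      by (metis Suc_eq_plus1_left add.assoc single_add)
    then show ?case using add[OF Suc] by simp
  qed (use that in simp)
  have "P (\<Sum>i\<in>K. single i (lookup m i))" if "finite K" for K
    using that by induction (use assms(1) step in auto)
  moreover have "(\<Sum>i\<in>keys m. single i (lookup m i)) = m"
    by (rule poly_mapping_eqI) (auto simp: lookup_sum lookup_single when_def in_keys_iff)
  ultimately show ?thesis by (metis finite_keys)
qed

text \<open>Substituting forms into a form gives a form, if the degree of what is substituted depends
  additively on the degree of the monomials.\<close>

lemma (in graded_polys) is_form_compose:
  fixes mdeg' :: "('j \<Rightarrow>\<^sub>0 nat) \<Rightarrow> 'e::comm_monoid_add"
  assumes "graded_polys mdeg'"
    and P: "P \<in> graded_polys.forms mdeg' e"
    and \<psi>: "\<psi> 0 = 0" "\<And>x y. \<psi> (x + y) = \<psi> x + \<psi> y"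
    and h: "\<And>j. is_form (\<psi> (mdeg' (single j 1))) (h j)"
  shows "is_form (\<psi> e) (\<lambda>v. eval_poly (\<lambda>j. h j v) P)"
proof -
  interpret G: graded_polys mdeg' by fact
  have "is_form (\<psi> (mdeg' m)) (\<lambda>v. eval_mono (\<lambda>j. h j v) m)" for m
  proof (induction m rule: poly_mapping_nat_induct)
    case zero
    show ?case using is_form_const[of 1] by (simp add: \<psi>)
  next
    case (add i m)
    show ?case
      unfolding eval_mono_add eval_mono_single power_one_right
      by (rule is_form_mult[OF h add]) (simp add: G.mdeg_add \<psi>)
  qed
  then have "is_form (\<psi> e) (\<lambda>v. lookup P m * eval_mono (\<lambda>j. h j v) m)" if "m \<in> keys P" for m
    using P that by (auto simp: G.forms_def intro!: is_form_cmult)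
  then show ?thesis
    unfolding eval_poly_def eval_mono_def[symmetric] by (rule is_form_sum)
qed

lemma sum_keys_add:
  fixes m n :: "'i \<Rightarrow>\<^sub>0 nat"
  shows "(\<Sum>k\<in>{k\<in>keys (m + n). Q k}. lookup (m + n) k) =
    (\<Sum>k\<in>{k\<in>keys m. Q k}. lookup m k) + (\<Sum>k\<in>{k\<in>keys n. Q k}. lookup n k)"
proof -
  let ?K = "{k \<in> keys m \<union> keys n. Q k}"
  have *: "(\<Sum>k\<in>{k\<in>keys l. Q k}. lookup l k) = (\<Sum>k\<in>?K. lookup l k)" if "keys l \<subseteq> keys m \<union> keys n" for l
    by (rule sum.mono_neutral_left) (use that in \<open>auto simp: in_keys_iff\<close>)
  show ?thesis
    unfolding *[OF keys_add] *[OF Un_upper1] *[OF Un_upper2] by (simp add: lookup_add sum.distrib)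
qed

lemma mono_degree_add: "mono_degree (m + n) = mono_degree m + mono_degree n"
  using sum_keys_add[of m n "\<lambda>_. True"] by (simp add: mono_degree_def)

definition mono_bidegree :: "('i + 'j \<Rightarrow>\<^sub>0 nat) \<Rightarrow> nat \<times> nat" where
  "mono_bidegree m = (\<Sum>k\<in>{k \<in> keys m. isl k}. lookup m k, \<Sum>k\<in>{k \<in> keys m. \<not> isl k}. lookup m k)"

global_interpretation homog: graded_polys "mono_degree :: ('i \<Rightarrow>\<^sub>0 nat) \<Rightarrow> nat"
  by standard (simp_all add: mono_degree_def[of 0] mono_degree_add)

global_interpretation bihomog: graded_polys "mono_bidegree :: ('i + 'j \<Rightarrow>\<^sub>0 nat) \<Rightarrow> nat \<times> nat"
  by standard (simp_all add: mono_bidegree_def sum_keys_add zero_prod_def)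

lemma homogeneous_polys_eq: "homogeneous_polys = homog.forms"
  by (auto simp: homogeneous_polys_def homog.forms_def)

lemma bihomogeneous_polys_eq: "bihomogeneous_polys = bihomog.forms"
  by (auto simp: bihomogeneous_polys_def bihomog.forms_def mono_bidegree_def fun_eq_iff)

lemma mono_degree_single [simp]: "mono_degree (single i n) = n"
  by (simp add: mono_degree_def)

lemma mono_bidegree_single [simp]:
  "mono_bidegree (single (Inl i) n) = (n, 0)" "mono_bidegree (single (Inr j) n) = (0, n)"
  by (auto simp: mono_bidegree_def)
     (auto intro!: sum.neutral simp: Collect_conv_if)


section \<open>Spaces with homogeneous coordinates\<close>

lemma points_subspace_on [simp]: "points (subspace_on X B) = points X \<inter> B"
  by (simp add: subspace_on_def topspace_subtopology)

lemma zariski_subspace_on [simp]: "zariski (subspace_on X B) = subtopology (zariski X) B"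
  by (simp add: subspace_on_def)

text \<open>Common ground of a projective space and a product of two of them: points have sets of coordinate
vectors, and passing to another coordinate vector of the same point multiplies all forms of a
given degree by the same nonzero constant. Hence the vanishing of a form at a point, and the quotient
of two forms of equal degree, are well defined.\<close>

locale coordinates = graded_polys mdeg
  for mdeg :: "('i \<Rightarrow>\<^sub>0 nat) \<Rightarrow> 'd::comm_monoid_add" +
  fixes A :: "'p set" and coords :: "'p \<Rightarrow> ('i \<Rightarrow> complex) set"
  assumes coords_nonempty: "a \<in> A \<Longrightarrow> \<exists>v. v \<in> coords a"
    and coords_scale: "a \<in> A \<Longrightarrow> v \<in> coords a \<Longrightarrow> w \<in> coords a \<Longrightarrow>
      \<exists>c. c \<noteq> 0 \<and> (\<forall>P\<in>forms d. eval_poly w P = c * eval_poly v P)"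
begin

definition cspace :: "'p fun_space" where "cspace = coordinate_space A coords forms"

definition principal :: "'i cpoly \<Rightarrow> 'p set" where
  "principal P = {a \<in> A. \<forall>v\<in>coords a. eval_poly v P \<noteq> 0}"

lemma zariski_cspace: "zariski cspace = topology_generated_by {principal P | P d. P \<in> forms d}"
  by (simp add: cspace_def coordinate_space_def principal_def Let_def)

lemma regular_on_cspace:
  "regular_on cspace W f \<longleftrightarrow> openin (zariski cspace) W \<and>
     (\<forall>a\<in>W. \<exists>N d G H. openin (zariski cspace) N \<and> a \<in> N \<and> N \<subseteq> W \<and> G \<in> forms d \<and> H \<in> forms d \<and>
        (\<forall>b\<in>N. \<forall>v\<in>coords b. eval_poly v H \<noteq> 0 \<and> f b = eval_poly v G / eval_poly v H))"
  by (simp add: cspace_def coordinate_space_def Let_def)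

lemma openin_principal: "P \<in> forms d \<Longrightarrow> openin (zariski cspace) (principal P)"
  unfolding zariski_cspace by (rule topology_generated_by_Basis) auto

lemma principal_mult: "principal (P * Q) = principal P \<inter> principal Q"
  by (auto simp: principal_def eval_poly_mult)

lemma in_principal:
  assumes "a \<in> A" "P \<in> forms d" "v \<in> coords a" "eval_poly v P \<noteq> 0"
  shows "a \<in> principal P"
  using assms coords_scale[of a v _ d] by (fastforce simp: principal_def)

lemma points_cspace [simp]: "points cspace = A"
proof -
  have "principal 1 = A" by (simp add: principal_def)
  moreover have "principal P \<subseteq> A" for P by (auto simp: principal_def)
  ultimately show ?thesis
    unfolding zariski_cspace topology_generated_by_topspace using one_in_forms by blast
qed

text \<open>Principal open sets are closed under intersection, because forms can be multiplied; so they are a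
basis of the topology and not only a subbasis.\<close>

lemma openin_imp_principal:
  assumes "openin (zariski cspace) W" "a \<in> W"
  shows "\<exists>P d. P \<in> forms d \<and> a \<in> principal P \<and> principal P \<subseteq> W"
proof -
  have "generate_topology_on {principal P | P d. P \<in> forms d} W"
    using assms(1) by (simp add: zariski_cspace openin_topology_generated_by)
  then show ?thesis
    using assms(2)
  proof (induction arbitrary: a)
    case (Int U V)
    obtain P d where P: "P \<in> forms d" "a \<in> principal P" "principal P \<subseteq> U"
      using Int by blast
    obtain Q e where Q: "Q \<in> forms e" "a \<in> principal Q" "principal Q \<subseteq> V"
      using Int by blast
    have "a \<in> principal (P * Q)" "principal (P * Q) \<subseteq> U \<inter> V"
      using P Q by (auto simp only: principal_mult)
    then show ?case
      using mult_in_forms[OF P(1) Q(1)] by blast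
  qed blast+
qed

lemma regular_on_subset:
  assumes f: "regular_on cspace W f" and W': "openin (zariski cspace) W'" "W' \<subseteq> W"
  shows "regular_on cspace W' f"
  unfolding regular_on_cspace
proof (intro conjI ballI)
  fix a assume "a \<in> W'"
  then have "a \<in> W" using W' by blast
  then obtain N d G H where N: "openin (zariski cspace) N" "a \<in> N" "N \<subseteq> W" "G \<in> forms d" "H \<in> forms d"
    "\<forall>b\<in>N. \<forall>v\<in>coords b. eval_poly v H \<noteq> 0 \<and> f b = eval_poly v G / eval_poly v H"
    using f unfolding regular_on_cspace by blast
  show "\<exists>N d G H. openin (zariski cspace) N \<and> a \<in> N \<and> N \<subseteq> W' \<and> G \<in> forms d \<and> H \<in> forms d \<and>
        (\<forall>b\<in>N. \<forall>v\<in>coords b. eval_poly v H \<noteq> 0 \<and> f b = eval_poly v G / eval_poly v H)"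
    using N W' \<open>a \<in> W'\<close> by (intro exI[of _ "N \<inter> W'"] exI[of _ d] exI[of _ G] exI[of _ H]) auto
qed fact

lemma regular_on_quotient:
  assumes G: "G \<in> forms d" and H: "H \<in> forms d" and W: "openin (zariski cspace) W" "W \<subseteq> principal H"
    and f: "\<And>b. b \<in> W \<Longrightarrow> \<exists>v\<in>coords b. f b = eval_poly v G / eval_poly v H"
  shows "regular_on cspace W f"
proof -
  have "eval_poly v H \<noteq> 0 \<and> f b = eval_poly v G / eval_poly v H" if bv: "b \<in> W" "v \<in> coords b" for b v
  proof -
    have b: "b \<in> A" "\<forall>v\<in>coords b. eval_poly v H \<noteq> 0"
      using W bv by (auto simp: principal_def)
    obtain w where w: "w \<in> coords b" "f b = eval_poly w G / eval_poly w H"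
      using f[OF bv(1)] by blast
    obtain c where "c \<noteq> 0" "\<forall>P\<in>forms d. eval_poly w P = c * eval_poly v P"
      using coords_scale[OF b(1) bv(2) w(1)] by blast
    then show ?thesis using G H w b bv by auto
  qed
  then show ?thesis
    unfolding regular_on_cspace using G H W by blast
qed

lemma regular_on_subspace:
  "regular_on (subspace_on X B) W f \<longleftrightarrow> openin (subtopology (zariski X) B) W \<and>
     (\<forall>a\<in>W. \<exists>N g. openin (zariski X) N \<and> a \<in> N \<and> regular_on X N g \<and> (\<forall>b\<in>N \<inter> W. f b = g b))"
  by (simp add: subspace_on_def)

text \<open>Regularity on a subspace means local extension to the ambient space; extending twice is the same as
extending once, since a regular function stays regular on smaller open sets.\<close>

lemma subspace_on_subspace_on:
  "subspace_on (subspace_on cspace B) C = subspace_on cspace (B \<inter> C)"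
proof -
  have "regular_on (subspace_on (subspace_on cspace B) C) W f \<longleftrightarrow>
        regular_on (subspace_on cspace (B \<inter> C)) W f" (is "?L \<longleftrightarrow> ?R") for W f
  proof
    assume L: ?L
    then have W: "openin (subtopology (zariski cspace) (B \<inter> C)) W"
      by (simp add: regular_on_subspace subtopology_subtopology)
    show ?R
      unfolding regular_on_subspace
    proof (intro conjI ballI W)
      fix a assume "a \<in> W"
      then obtain N g where N: "openin (subtopology (zariski cspace) B) N" "a \<in> N"
        "regular_on (subspace_on cspace B) N g" "\<forall>b\<in>N \<inter> W. f b = g b"
        using L by (auto simp: regular_on_subspace[of "subspace_on _ _"])
      then obtain N' g' where N': "openin (zariski cspace) N'" "a \<in> N'" "regular_on cspace N' g'"
        "\<forall>b\<in>N' \<inter> N. g b = g' b"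
        by (auto simp: regular_on_subspace)
      obtain M where M: "openin (zariski cspace) M" "N = M \<inter> B"
        using N(1) by (auto simp: openin_subtopology)
      have "W \<subseteq> B" using openin_subset[OF W] by auto
      then have "\<forall>b\<in>(N' \<inter> M) \<inter> W. f b = g' b"
        using M N N' by auto
      moreover have "regular_on cspace (N' \<inter> M) g'" "openin (zariski cspace) (N' \<inter> M)"
        using N' M by (auto intro: regular_on_subset)
      ultimately show "\<exists>N g. openin (zariski cspace) N \<and> a \<in> N \<and> regular_on cspace N g \<and>
          (\<forall>b\<in>N \<inter> W. f b = g b)"
        using M N N' by blast
    qed
  next
    assume R: ?R
    then have W: "openin (subtopology (zariski cspace) (B \<inter> C)) W"
      by (simp add: regular_on_subspace)
    then have "W \<subseteq> B" using openin_subset by fastforce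
    show ?L
      unfolding regular_on_subspace[of "subspace_on _ _"]
    proof (intro conjI ballI)
      show "openin (subtopology (zariski (subspace_on cspace B)) C) W"
        using W by (simp add: subtopology_subtopology)
      fix a assume "a \<in> W"
      then obtain N g where N: "openin (zariski cspace) N" "a \<in> N" "regular_on cspace N g"
        "\<forall>b\<in>N \<inter> W. f b = g b"
        using R by (auto simp: regular_on_subspace)
      have "openin (subtopology (zariski cspace) B) (N \<inter> B)"
        using N(1) by (auto simp: openin_subtopology)
      moreover have "regular_on (subspace_on cspace B) (N \<inter> B) g"
        using N calculation by (auto simp: regular_on_subspace)
      ultimately show "\<exists>N g. openin (zariski (subspace_on cspace B)) N \<and> a \<in> N \<and>
          regular_on (subspace_on cspace B) N g \<and> (\<forall>b\<in>N \<inter> W. f b = g b)"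
        using N \<open>a \<in> W\<close> \<open>W \<subseteq> B\<close> by (intro exI[of _ "N \<inter> B"] exI[of _ g]) auto
    qed
  qed
  then show ?thesis
    by (intro fun_space.equality) (auto simp: subtopology_subtopology fun_eq_iff)
qed

text \<open>Forms of suitable degrees that compute homogeneous coordinates of \<open>f a\<close> from those of \<open>a\<close>
  make \<open>f\<close> a morphism: they pull back principal open sets to principal open sets, and quotients of
  forms of equal degree to such quotients.\<close>

lemma morphism_by_forms:
  fixes mdeg' :: "('j \<Rightarrow>\<^sub>0 nat) \<Rightarrow> 'e::comm_monoid_add"
  assumes "coordinates mdeg' A' coords'"
    and S: "S \<subseteq> A" "f ` S \<subseteq> A'"
    and \<psi>: "\<psi> 0 = 0" "\<And>x y. \<psi> (x + y) = \<psi> x + \<psi> y"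
    and h: "\<And>j. is_form (\<psi> (mdeg' (single j 1))) (h j)"
    and f: "\<And>a v. a \<in> S \<Longrightarrow> v \<in> coords a \<Longrightarrow> (\<lambda>j. h j v) \<in> coords' (f a)"
  shows "morphism (subspace_on cspace S) (coordinates.cspace mdeg' A' coords') f"
proof -
  interpret C: coordinates mdeg' A' coords' by fact
  have pull: "\<exists>Q\<in>forms (\<psi> d). \<forall>v. eval_poly v Q = eval_poly (\<lambda>j. h j v) P" if "P \<in> C.forms d" for P d
    using is_form_compose[OF C.graded_polys_axioms that \<psi> h] by (auto simp: is_form_def)
  have pre: "{a \<in> S. f a \<in> C.principal P} = principal Q \<inter> S"
    if P: "P \<in> C.forms d" and Q: "Q \<in> forms (\<psi> d)" "\<forall>v. eval_poly v Q = eval_poly (\<lambda>j. h j v) P" for P Q d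
  proof (intro set_eqI iffI)
    fix a assume "a \<in> {a \<in> S. f a \<in> C.principal P}"
    then show "a \<in> principal Q \<inter> S"
      using f Q S by (auto simp: C.principal_def principal_def)
  next
    fix a assume a: "a \<in> principal Q \<inter> S"
    obtain v where "v \<in> coords a" using a S coords_nonempty by blast
    then show "a \<in> {a \<in> S. f a \<in> C.principal P}"
      using a S Q(2) P f[of a v] C.in_principal[of "f a" P d "\<lambda>j. h j v"]
      by (auto simp: principal_def)
  qed
  have cont: "continuous_map (subtopology (zariski cspace) S) (zariski C.cspace) f"
    unfolding C.zariski_cspace continuous_on_generated_topo_iff
  proof (intro conjI allI impI)
    fix U assume "U \<in> {C.principal P |P d. P \<in> C.forms d}"
    then obtain P d where P: "U = C.principal P" "P \<in> C.forms d" by blast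
    obtain Q where Q: "Q \<in> forms (\<psi> d)" "\<forall>v. eval_poly v Q = eval_poly (\<lambda>j. h j v) P"
      using pull[OF P(2)] by blast
    have "f -` U \<inter> topspace (subtopology (zariski cspace) S) = principal Q \<inter> S"
      using pre[OF P(2) Q] S P by auto
    then show "openin (subtopology (zariski cspace) S) (f -` U \<inter> topspace (subtopology (zariski cspace) S))"
      using openin_principal[OF Q(1)] by (auto simp: openin_subtopology)
  next
    show "f ` topspace (subtopology (zariski cspace) S) \<subseteq> \<Union> {C.principal P |P d. P \<in> C.forms d}"
      using S C.points_cspace unfolding C.zariski_cspace topology_generated_by_topspace by auto
  qed
  have "regular_on (subspace_on cspace S) {x \<in> points (subspace_on cspace S). f x \<in> W} (g \<circ> f)"
    if g: "regular_on C.cspace W g" for W g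
    unfolding regular_on_subspace
  proof (intro conjI ballI)
    let ?W = "{x \<in> points (subspace_on cspace S). f x \<in> W}"
    show "openin (subtopology (zariski cspace) S) ?W"
      using openin_continuous_map_preimage[OF cont, of W] g by (simp add: C.regular_on_cspace)
    fix a assume a: "a \<in> ?W"
    obtain N d G H where N: "openin (zariski C.cspace) N" "f a \<in> N" "N \<subseteq> W" "G \<in> C.forms d" "H \<in> C.forms d"
      "\<forall>b\<in>N. \<forall>v\<in>coords' b. eval_poly v H \<noteq> 0 \<and> g b = eval_poly v G / eval_poly v H"
      using g a unfolding C.regular_on_cspace by blast
    obtain G' where G': "G' \<in> forms (\<psi> d)" "\<forall>v. eval_poly v G' = eval_poly (\<lambda>j. h j v) G"
      using pull[OF N(4)] by blast
    obtain H' where H': "H' \<in> forms (\<psi> d)" "\<forall>v. eval_poly v H' = eval_poly (\<lambda>j. h j v) H"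
      using pull[OF N(5)] by blast
    have "openin (subtopology (zariski cspace) S) {x \<in> topspace (subtopology (zariski cspace) S). f x \<in> N}"
      using cont N(1) by (rule openin_continuous_map_preimage)
    then obtain M where M: "openin (zariski cspace) M" "{x \<in> A \<inter> S. f x \<in> N} = M \<inter> S"
      by (auto simp: openin_subtopology)
    let ?N = "M \<inter> principal H'"
    define g' where "g' b = (let v = SOME v. v \<in> coords b in eval_poly v G' / eval_poly v H')" for b
    have N': "openin (zariski cspace) ?N"
      using M openin_principal[OF H'(1)] by auto
    have some: "(SOME v. v \<in> coords b) \<in> coords b" if "b \<in> A" for b
      using coords_nonempty[OF that] by (rule someI_ex)
    have "regular_on cspace ?N g'"
    proof (rule regular_on_quotient[OF G'(1) H'(1) N'])
      show "\<exists>v\<in>coords b. g' b = eval_poly v G' / eval_poly v H'" if "b \<in> ?N" for b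
        using some[of b] that by (auto simp: g'_def Let_def principal_def)
    qed simp
    moreover have "a \<in> ?N"
    proof -
      have "f a \<in> C.principal H"
        using N a S by (auto simp: C.principal_def)
      then have "a \<in> principal H'" using pre[OF N(5) H'] a by auto
      moreover have "a \<in> M" using M(2) a N(2) by auto
      ultimately show ?thesis by blast
    qed
    moreover have "(g \<circ> f) b = g' b" if "b \<in> ?N \<inter> ?W" for b
    proof -
      have b: "b \<in> A" "b \<in> S" "f b \<in> N" using that M(2) by auto
      show ?thesis
        using N(6) b(3) f[OF b(2) some[OF b(1)]] G'(2) H'(2) by (auto simp: g'_def Let_def)
    qed
    ultimately show "\<exists>N g'. openin (zariski cspace) N \<and> a \<in> N \<and> regular_on cspace N g' \<and>
        (\<forall>b\<in>N \<inter> ?W. (g \<circ> f) b = g' b)"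
      using N' by (intro exI[of _ ?N] exI[of _ g']) auto
  qed
  then show ?thesis using cont by (simp add: morphism_def)
qed

lemma morphism_into_subspace:
  assumes f: "morphism (subspace_on cspace S) Y f" "f ` S \<subseteq> B" and S: "S \<subseteq> A"
  shows "morphism (subspace_on cspace S) (subspace_on Y B) f"
proof -
  have cont: "continuous_map (subtopology (zariski cspace) S) (subtopology (zariski Y) B) f"
    using f by (auto simp: morphism_def continuous_map_in_subtopology)
  have "regular_on (subspace_on cspace S) {x \<in> points (subspace_on cspace S). f x \<in> W} (g \<circ> f)"
    if g: "regular_on (subspace_on Y B) W g" for W g
    unfolding regular_on_subspace
  proof (intro conjI ballI)
    let ?W = "{x \<in> points (subspace_on cspace S). f x \<in> W}"
    show "openin (subtopology (zariski cspace) S) ?W"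
      using openin_continuous_map_preimage[OF cont, of W] g by (simp add: regular_on_subspace)
    fix a assume a: "a \<in> ?W"
    then obtain N g' where N: "openin (zariski Y) N" "f a \<in> N" "regular_on Y N g'" "\<forall>b\<in>N \<inter> W. g b = g' b"
      using g unfolding regular_on_subspace by blast
    have "regular_on (subspace_on cspace S) {x \<in> points (subspace_on cspace S). f x \<in> N} (g' \<circ> f)"
      using f(1) N(3) by (simp add: morphism_def)
    then obtain M h where M: "openin (zariski cspace) M" "a \<in> M" "regular_on cspace M h"
      "\<forall>b\<in>M \<inter> {x \<in> points (subspace_on cspace S). f x \<in> N}. (g' \<circ> f) b = h b"
      and op: "openin (subtopology (zariski cspace) S) {x \<in> points (subspace_on cspace S). f x \<in> N}"
      using a N(2) unfolding regular_on_subspace by blast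
    obtain K where K: "openin (zariski cspace) K" "{x \<in> points (subspace_on cspace S). f x \<in> N} = K \<inter> S"
      using op by (auto simp: openin_subtopology)
    have "regular_on cspace (M \<inter> K) h" using M K by (auto intro: regular_on_subset)
    moreover have "a \<in> M \<inter> K" using M K a N(2) by blast
    moreover have "(g \<circ> f) b = h b" if "b \<in> (M \<inter> K) \<inter> ?W" for b
    proof -
      have "b \<in> M \<inter> {x \<in> points (subspace_on cspace S). f x \<in> N}" using K(2) that by auto
      then show ?thesis using M(4) N(4) that by auto
    qed
    ultimately show "\<exists>N g'. openin (zariski cspace) N \<and> a \<in> N \<and> regular_on cspace N g' \<and>
        (\<forall>b\<in>N \<inter> ?W. (g \<circ> f) b = g' b)"
      using M(1) K(1) by (intro exI[of _ "M \<inter> K"] exI[of _ h]) auto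
  qed
  then show ?thesis using cont by (simp add: morphism_def)
qed

end


section \<open>Irreducibility\<close>

text \<open>Irreducibility in terms of open sets. It is used in this form both for irreducibility itself and
for the density of nonempty open sets, that is, dominance.\<close>

definition hyperconnected :: "'a topology \<Rightarrow> bool" where
  "hyperconnected T \<longleftrightarrow> (\<forall>U V. openin T U \<and> openin T V \<and> U \<noteq> {} \<and> V \<noteq> {} \<longrightarrow> U \<inter> V \<noteq> {})"

lemma hyperconnected_imp_irreducible:
  assumes "hyperconnected (zariski X)" "points X \<noteq> {}"
  shows "irreducible_variety X"
  unfolding irreducible_variety_def
proof (intro conjI allI impI)
  fix C D assume CD: "closedin (zariski X) C \<and> closedin (zariski X) D \<and> C \<union> D = points X"
  then have "openin (zariski X) (points X - C)" "openin (zariski X) (points X - D)"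
    by auto
  moreover have "(points X - C) \<inter> (points X - D) = {}" using CD by blast
  ultimately have "points X - C = {} \<or> points X - D = {}"
    using assms(1) unfolding hyperconnected_def by blast
  then show "C = points X \<or> D = points X" using CD by blast
qed fact

lemma hyperconnected_dense:
  assumes "hyperconnected T" "openin T W" "W \<noteq> {}"
  shows "T closure_of W = topspace T"
  using assms by (auto simp: hyperconnected_def closure_of_def)

definition poly_fun :: "(complex \<Rightarrow> complex) \<Rightarrow> bool" where
  "poly_fun h \<longleftrightarrow> (\<exists>p. \<forall>s. h s = poly p s)"

lemma poly_fun_const: "poly_fun (\<lambda>s. c)"
  by (auto simp: poly_fun_def intro!: exI[of _ "[:c:]"])

lemma poly_fun_id: "poly_fun (\<lambda>s. s)"
  by (auto simp: poly_fun_def intro!: exI[of _ "[:0, 1:]"])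

lemma poly_fun_add: "poly_fun g \<Longrightarrow> poly_fun h \<Longrightarrow> poly_fun (\<lambda>s. g s + h s)"
  by (force simp: poly_fun_def simp flip: poly_add)

lemma poly_fun_diff: "poly_fun g \<Longrightarrow> poly_fun h \<Longrightarrow> poly_fun (\<lambda>s. g s - h s)"
  by (force simp: poly_fun_def simp flip: poly_diff)

lemma poly_fun_mult: "poly_fun g \<Longrightarrow> poly_fun h \<Longrightarrow> poly_fun (\<lambda>s. g s * h s)"
  by (force simp: poly_fun_def simp flip: poly_mult)

lemma poly_fun_power: "poly_fun g \<Longrightarrow> poly_fun (\<lambda>s. g s ^ n)"
  by (force simp: poly_fun_def simp flip: poly_power)

lemma poly_fun_sum: "(\<And>a. a \<in> A \<Longrightarrow> poly_fun (h a)) \<Longrightarrow> poly_fun (\<lambda>s. \<Sum>a\<in>A. h a s)"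
  by (induction A rule: infinite_finite_induct) (auto intro: poly_fun_const poly_fun_add)

lemma poly_fun_prod: "(\<And>a. a \<in> A \<Longrightarrow> poly_fun (h a)) \<Longrightarrow> poly_fun (\<lambda>s. \<Prod>a\<in>A. h a s)"
  by (induction A rule: infinite_finite_induct) (auto intro: poly_fun_const poly_fun_mult)

lemmas poly_fun_intros = poly_fun_const poly_fun_id poly_fun_add poly_fun_diff poly_fun_mult

lemma poly_fun_eval_poly:
  assumes "\<And>i. poly_fun (\<lambda>s. \<gamma> s i)"
  shows "poly_fun (\<lambda>s. eval_poly (\<gamma> s) P)"
  unfolding eval_poly_def
  by (intro poly_fun_sum poly_fun_mult poly_fun_prod poly_fun_power poly_fun_const assms)

text \<open>A product of nonzero polynomials in one variable is nonzero, and the complex numbers are infinite.\<close>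

lemma poly_fun_common_nonzero:
  assumes "poly_fun f" "f s \<noteq> 0" "poly_fun g" "g t \<noteq> 0" "poly_fun h" "h u \<noteq> 0"
  shows "\<exists>r. f r \<noteq> 0 \<and> g r \<noteq> 0 \<and> h r \<noteq> 0"
proof -
  obtain p q r where pqr: "\<And>s. f s = poly p s" "\<And>s. g s = poly q s" "\<And>s. h s = poly r s"
    using assms by (auto simp: poly_fun_def)
  have "p * q * r \<noteq> 0" using assms by (auto simp: pqr)
  then obtain x where "poly (p * q * r) x \<noteq> 0"
    using poly_all_0_iff_0 by blast
  then show ?thesis by (auto simp: pqr)
qed

text \<open>Forms that do not vanish at the first and at the second point, respectively, restrict to
  nonzero polynomials in the parameter of a curve joining these points, so both are nonzero at a
  common point of the curve. The polynomial \<open>\<delta>\<close> takes care of the finitely many parameters at which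
  the curve may leave the set, for example because the coordinate vector vanishes.\<close>

lemma (in coordinates) hyperconnected_by_curves:
  assumes curves: "\<And>a b. a \<in> S \<Longrightarrow> b \<in> S \<Longrightarrow> \<exists>\<gamma> \<delta>. (\<forall>i. poly_fun (\<lambda>s. \<gamma> s i)) \<and> poly_fun \<delta> \<and> \<delta> 0 \<noteq> 0 \<and>
      \<gamma> 0 \<in> coords a \<and> \<gamma> 1 \<in> coords b \<and> (\<forall>s. \<delta> s \<noteq> 0 \<longrightarrow> (\<exists>c\<in>S. \<gamma> s \<in> coords c))"
    and S: "S \<subseteq> A"
  shows "hyperconnected (subtopology (zariski cspace) S)"
  unfolding hyperconnected_def
proof (intro allI impI)
  fix U V assume UV: "openin (subtopology (zariski cspace) S) U \<and> openin (subtopology (zariski cspace) S) V \<and>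
    U \<noteq> {} \<and> V \<noteq> {}"
  then obtain U' V' where U': "openin (zariski cspace) U'" "U = U' \<inter> S"
    and V': "openin (zariski cspace) V'" "V = V' \<inter> S"
    by (auto simp: openin_subtopology)
  obtain a b where ab: "a \<in> U" "b \<in> V" using UV by blast
  obtain P d where P: "P \<in> forms d" "a \<in> principal P" "principal P \<subseteq> U'"
    using openin_imp_principal[of U' a] U' ab by blast
  obtain Q e where Q: "Q \<in> forms e" "b \<in> principal Q" "principal Q \<subseteq> V'"
    using openin_imp_principal[of V' b] V' ab by blast
  obtain \<gamma> \<delta> where \<gamma>: "\<forall>i. poly_fun (\<lambda>s. \<gamma> s i)" "poly_fun \<delta>" "\<delta> 0 \<noteq> 0" "\<gamma> 0 \<in> coords a" "\<gamma> 1 \<in> coords b"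
    "\<forall>s. \<delta> s \<noteq> 0 \<longrightarrow> (\<exists>c\<in>S. \<gamma> s \<in> coords c)"
    using curves[of a b] ab U' V' by blast
  have "poly_fun (\<lambda>s. eval_poly (\<gamma> s) P)" "poly_fun (\<lambda>s. eval_poly (\<gamma> s) Q)"
    using \<gamma>(1) by (auto intro: poly_fun_eval_poly)
  moreover have "eval_poly (\<gamma> 0) P \<noteq> 0" "eval_poly (\<gamma> 1) Q \<noteq> 0"
    using \<gamma> P Q by (auto simp: principal_def)
  ultimately obtain s where s: "eval_poly (\<gamma> s) P \<noteq> 0" "eval_poly (\<gamma> s) Q \<noteq> 0" "\<delta> s \<noteq> 0"
    using poly_fun_common_nonzero[of _ 0 _ 1 \<delta> 0] \<gamma>(2,3) by blast
  then obtain c where c: "c \<in> S" "\<gamma> s \<in> coords c" using \<gamma>(6) by blast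
  then have "c \<in> principal P" "c \<in> principal Q"
    using in_principal S P Q s by blast+
  then show "U \<inter> V \<noteq> {}" using c U' V' P Q by blast
qed


section \<open>Projective spaces and their products\<close>

lemma lookup_scale_vec [simp]: "lookup (scale_vec c v) i = c * lookup v i"
  by (auto simp: scale_vec_def Poly_Mapping.map.rep_eq when_def in_keys_iff)

text \<open>The points of the projective space on \<open>I\<close> are given by functions on all indices; the values outside of
\<open>I\<close> are ignored.\<close>

definition vec_on :: "'i set \<Rightarrow> ('i \<Rightarrow> complex) \<Rightarrow> ('i \<Rightarrow>\<^sub>0 complex)" where
  "vec_on I h = (\<Sum>i\<in>I. single i (h i))"

definition point :: "'i set \<Rightarrow> ('i \<Rightarrow> complex) \<Rightarrow> ('i \<Rightarrow>\<^sub>0 complex) set" where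
  "point I h = range (\<lambda>c. scale_vec c (vec_on I h))"

lemma lookup_vec_on: "finite I \<Longrightarrow> lookup (vec_on I h) i = (if i \<in> I then h i else 0)"
  by (simp add: vec_on_def lookup_sum lookup_single when_def)

lemma line_coords_line:
  assumes "v \<noteq> 0"
  shows "w \<in> line_coords (range (\<lambda>c. scale_vec c v)) \<longleftrightarrow> (\<exists>c. c \<noteq> 0 \<and> w = (\<lambda>i. c * lookup v i))"
proof
  assume "w \<in> line_coords (range (\<lambda>c. scale_vec c v))"
  then obtain c where c: "scale_vec c v \<noteq> 0" "w = lookup (scale_vec c v)"
    by (auto simp: line_coords_def)
  have "c \<noteq> 0"
    using c(1) by (auto simp: poly_mapping_eq_iff fun_eq_iff)
  then show "\<exists>c. c \<noteq> 0 \<and> w = (\<lambda>i. c * lookup v i)"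
    using c by (auto simp: fun_eq_iff)
next
  assume "\<exists>c. c \<noteq> 0 \<and> w = (\<lambda>i. c * lookup v i)"
  then obtain c where c: "c \<noteq> 0" "w = (\<lambda>i. c * lookup v i)" by blast
  then have "w = lookup (scale_vec c v)" "scale_vec c v \<noteq> 0"
    using assms by (auto simp: fun_eq_iff poly_mapping_eq_iff)
  then show "w \<in> line_coords (range (\<lambda>c. scale_vec c v))"
    unfolding line_coords_def by blast
qed

lemma line_coords_iff:
  assumes "L \<in> lines I" "u \<in> line_coords L"
  shows "w \<in> line_coords L \<longleftrightarrow> (\<exists>c. c \<noteq> 0 \<and> w = (\<lambda>i. c * u i))"
proof -
  obtain v where v: "v \<noteq> 0" "L = range (\<lambda>c. scale_vec c v)"
    using assms by (auto simp: lines_def)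
  obtain a where a: "a \<noteq> 0" "u = (\<lambda>i. a * lookup v i)"
    using assms(2) line_coords_line[OF v(1)] v(2) by auto
  have "(\<exists>c. c \<noteq> 0 \<and> w = (\<lambda>i. c * lookup v i)) \<longleftrightarrow> (\<exists>c. c \<noteq> 0 \<and> w = (\<lambda>i. c * u i))"
  proof (intro iffI; elim exE conjE)
    fix c assume "c \<noteq> 0" "w = (\<lambda>i. c * lookup v i)"
    then show "\<exists>c. c \<noteq> 0 \<and> w = (\<lambda>i. c * u i)"
      using a by (intro exI[of _ "c / a"]) auto
  next
    fix c assume "c \<noteq> 0" "w = (\<lambda>i. c * u i)"
    then show "\<exists>c. c \<noteq> 0 \<and> w = (\<lambda>i. c * lookup v i)"
      using a by (intro exI[of _ "c * a"]) auto
  qed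
  then show ?thesis using line_coords_line[OF v(1)] v(2) by simp
qed

lemma line_coords_scale: "L \<in> lines I \<Longrightarrow> u \<in> line_coords L \<Longrightarrow> c \<noteq> 0 \<Longrightarrow> (\<lambda>i. c * u i) \<in> line_coords L"
  using line_coords_iff by blast

lemma line_coords_nonempty: "L \<in> lines I \<Longrightarrow> \<exists>u. u \<in> line_coords L"
  by (auto simp: lines_def line_coords_line intro: exI[of _ 1])

lemma line_coords_support: "L \<in> lines I \<Longrightarrow> u \<in> line_coords L \<Longrightarrow> i \<notin> I \<Longrightarrow> u i = 0"
  by (auto simp: lines_def line_coords_line subset_iff in_keys_iff) metis

lemma line_coords_nonzero:
  assumes "L \<in> lines I" "u \<in> line_coords L"
  shows "\<exists>i\<in>I. u i \<noteq> 0"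
proof -
  obtain i where "u i \<noteq> 0"
    using assms(2) by (auto simp: line_coords_def poly_mapping_eq_iff fun_eq_iff)
  then show ?thesis using line_coords_support[OF assms] by blast
qed

lemma point_in_lines:
  assumes "finite I" "i \<in> I" "h i \<noteq> 0"
  shows "point I h \<in> lines I"
proof -
  have "lookup (vec_on I h) i \<noteq> 0"
    using assms by (simp add: lookup_vec_on)
  then have "vec_on I h \<noteq> 0" by auto
  moreover have "keys (vec_on I h) \<subseteq> I"
    using assms(1) by (auto simp: in_keys_iff lookup_vec_on split: if_splits)
  ultimately show ?thesis by (auto simp: lines_def point_def)
qed

lemma point_coords:
  assumes "finite I" "i \<in> I" "h i \<noteq> 0" "\<And>j. j \<notin> I \<Longrightarrow> h j = 0"
  shows "h \<in> line_coords (point I h)"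
proof -
  have "lookup (vec_on I h) = h"
    using assms by (auto simp: lookup_vec_on fun_eq_iff)
  moreover from this have "vec_on I h \<noteq> 0" using assms by auto
  ultimately show ?thesis
    by (auto simp: point_def line_coords_line intro!: exI[of _ 1])
qed

lemma point_scale:
  assumes "finite I" "c \<noteq> 0"
  shows "point I (\<lambda>i. c * h i) = point I h"
proof -
  have *: "scale_vec a (vec_on I (\<lambda>i. c * h i)) = scale_vec (a * c) (vec_on I h)" for a
    using assms by (intro poly_mapping_eqI) (simp add: lookup_vec_on)
  have "scale_vec b (vec_on I h) = scale_vec (b / c) (vec_on I (\<lambda>i. c * h i))" for b
    using assms by (subst *) simp
  then show ?thesis
    unfolding point_def using * by blast
qed

lemma point_cong: "(\<And>i. i \<in> I \<Longrightarrow> g i = h i) \<Longrightarrow> point I g = point I h"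
  by (simp add: point_def vec_on_def)

lemma line_eq_point:
  assumes "finite I" "L \<in> lines I" "u \<in> line_coords L"
  shows "L = point I u"
proof -
  obtain v where v: "v \<noteq> 0" "L = range (\<lambda>c. scale_vec c v)" "keys v \<subseteq> I"
    using assms by (auto simp: lines_def)
  then have v': "v = vec_on I (lookup v)"
    using assms(1) by (intro poly_mapping_eqI) (auto simp: lookup_vec_on in_keys_iff)
  obtain c where c: "c \<noteq> 0" "u = (\<lambda>i. c * lookup v i)"
    using assms(3) line_coords_line[OF v(1)] v(2) by auto
  have "L = point I (lookup v)"
    unfolding v(2) point_def v'[symmetric] ..
  then show ?thesis using point_scale[OF assms(1) c(1)] c(2) by simp
qed

lemma eval_mono_scale: "eval_mono (\<lambda>i. c * v i) m = c ^ mono_degree m * eval_mono v m"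
  by (simp add: eval_mono_def mono_degree_def power_mult_distrib prod.distrib power_sum)

lemma eval_poly_scale:
  "P \<in> homog.forms d \<Longrightarrow> eval_poly (\<lambda>i. c * v i) P = c ^ d * eval_poly v P"
  by (auto simp: homog.forms_def eval_poly_def eval_mono_def[symmetric] eval_mono_scale
      sum_distrib_left mult_ac intro!: sum.cong)

lemma eval_mono_biscale:
  "eval_mono (case_sum (\<lambda>i. c * u i) (\<lambda>j. c' * v j)) m =
     c ^ fst (mono_bidegree m) * c' ^ snd (mono_bidegree m) * eval_mono (case_sum u v) m"
proof (induction m rule: poly_mapping_nat_induct)
  case (add i m)
  then show ?case
    by (cases i) (simp_all add: eval_mono_add bihomog.mdeg_add power_add mult_ac)
qed simp

lemma eval_poly_biscale:
  "P \<in> bihomog.forms (d, e) \<Longrightarrow>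
     eval_poly (case_sum (\<lambda>i. c * u i) (\<lambda>j. c' * v j)) P = c ^ d * c' ^ e * eval_poly (case_sum u v) P"
  by (auto simp: bihomog.forms_def eval_poly_def eval_mono_def[symmetric] eval_mono_biscale
      sum_distrib_left mult_ac intro!: sum.cong)

lemma pair_coords_iff:
  "w \<in> pair_coords (L, M) \<longleftrightarrow> (\<exists>u\<in>line_coords L. \<exists>v\<in>line_coords M. w = case_sum u v)"
  by (auto simp: pair_coords_def)

global_interpretation proj: coordinates mono_degree "lines I" line_coords for I
proof
  fix a :: "('a \<Rightarrow>\<^sub>0 complex) set" and v w d
  assume "a \<in> lines I" "v \<in> line_coords a" "w \<in> line_coords a"
  then obtain c where "c \<noteq> 0" "w = (\<lambda>i. c * v i)" using line_coords_iff by blast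
  then show "\<exists>c. c \<noteq> 0 \<and> (\<forall>P\<in>homog.forms d. eval_poly w P = c * eval_poly v P)"
    by (intro exI[of _ "c ^ d"]) (simp add: eval_poly_scale)
qed (rule line_coords_nonempty)

global_interpretation biproj: coordinates mono_bidegree "lines I \<times> lines J" pair_coords for I J
proof
  fix a :: "('a \<Rightarrow>\<^sub>0 complex) set \<times> ('b \<Rightarrow>\<^sub>0 complex) set" and v w d
  assume a: "a \<in> lines I \<times> lines J" and vw: "v \<in> pair_coords a" "w \<in> pair_coords a"
  obtain L M where LM: "a = (L, M)" "L \<in> lines I" "M \<in> lines J" using a by auto
  obtain x y where x: "x \<in> line_coords L" "y \<in> line_coords M" "v = case_sum x y"
    using vw LM by (auto simp: pair_coords_iff)
  obtain x' y' where y: "x' \<in> line_coords L" "y' \<in> line_coords M" "w = case_sum x' y'"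
    using vw LM by (auto simp: pair_coords_iff)
  obtain c where c: "c \<noteq> 0" "x' = (\<lambda>i. c * x i)" using line_coords_iff LM x y by blast
  obtain c' where c': "c' \<noteq> 0" "y' = (\<lambda>i. c' * y i)" using line_coords_iff LM x y by blast
  show "\<exists>c. c \<noteq> 0 \<and> (\<forall>P\<in>bihomog.forms d. eval_poly w P = c * eval_poly v P)"
    using c c' x y
    by (cases d) (auto simp: eval_poly_biscale intro!: exI[of _ "c ^ fst d * c' ^ snd d"])
next
  fix a :: "('a \<Rightarrow>\<^sub>0 complex) set \<times> ('b \<Rightarrow>\<^sub>0 complex) set"
  assume "a \<in> lines I \<times> lines J"
  then obtain L M u v where "a = (L, M)" "u \<in> line_coords L" "v \<in> line_coords M"
    using line_coords_nonempty by (metis mem_Sigma_iff surj_pair)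
  then show "\<exists>v. v \<in> pair_coords a"
    by (auto simp: pair_coords_iff)
qed

lemma projectivization_eq: "projectivization I = proj.cspace I"
  by (simp add: projectivization_def proj.cspace_def homogeneous_polys_eq)

lemma biprojectivization_eq: "biprojectivization I J = biproj.cspace I J"
  by (simp add: biprojectivization_def biproj.cspace_def bihomogeneous_polys_eq)

lemma hyperconnected_projective_space: "hyperconnected (zariski (projective_space n))"
proof -
  let ?I = "{..n}"
  have "hyperconnected (subtopology (zariski (proj.cspace ?I)) (lines ?I))"
  proof (rule proj.hyperconnected_by_curves)
    fix a b assume ab: "a \<in> lines ?I" "b \<in> lines ?I"
    obtain u w where u: "u \<in> line_coords a" and w: "w \<in> line_coords b"
      using ab line_coords_nonempty by metis
    obtain i where i: "i \<in> ?I" "u i \<noteq> 0" using line_coords_nonzero ab u by blast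
    define \<gamma> where "\<gamma> s j = u j + s * (w j - u j)" for s j
    have poly: "poly_fun (\<lambda>s. \<gamma> s j)" for j
      unfolding \<gamma>_def by (intro poly_fun_intros)
    have "\<exists>c\<in>lines ?I. \<gamma> s \<in> line_coords c" if "\<gamma> s i \<noteq> 0" for s
      using that i line_coords_support[OF ab(1) u] line_coords_support[OF ab(2) w]
      by (intro bexI[of _ "point ?I (\<gamma> s)"] point_coords point_in_lines) (auto simp: \<gamma>_def)
    moreover have "\<gamma> 0 = u" "\<gamma> 1 = w" by (auto simp: \<gamma>_def)
    ultimately show "\<exists>\<gamma> \<delta>. (\<forall>i. poly_fun (\<lambda>s. \<gamma> s i)) \<and> poly_fun \<delta> \<and> \<delta> 0 \<noteq> 0 \<and>
      \<gamma> 0 \<in> line_coords a \<and> \<gamma> 1 \<in> line_coords b \<and> (\<forall>s. \<delta> s \<noteq> 0 \<longrightarrow> (\<exists>c\<in>lines ?I. \<gamma> s \<in> line_coords c))"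
      using poly i u w by (intro exI[of _ \<gamma>] exI[of _ "\<lambda>s. \<gamma> s i"]) auto
  qed simp
  then show ?thesis
    using subtopology_topspace[of "zariski (proj.cspace ?I)"]
    by (simp add: projective_space_def projectivization_eq)
qed


section \<open>Ternary cubics\<close>

lemma UNIV_3': "UNIV = {0, 1, 2 :: 3}"
  using UNIV_3 by auto

lemma three_eq_0 [simp]: "(3::3) = 0"
  by simp

lemma sum_3': "sum f (UNIV :: 3 set) = f 0 + f 1 + f 2"
  unfolding UNIV_3' by (simp add: ac_simps)

lemma prod_3': "prod f (UNIV :: 3 set) = f 0 * f 1 * f 2"
  unfolding UNIV_3' by (simp add: ac_simps)

lemma cases_3: "i = 0 \<or> i = 1 \<or> i = (2::3)"
  using UNIV_3' by auto

text \<open>Cubic forms are written out through their ten coefficients, indexed by the exponents of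
\<open>x\<^sub>0\<close>, \<open>x\<^sub>1\<close>, \<open>x\<^sub>2\<close>.\<close>

definition expo :: "nat \<Rightarrow> nat \<Rightarrow> nat \<Rightarrow> (3 \<Rightarrow>\<^sub>0 nat)" where
  "expo i j k = single 0 i + single 1 j + single 2 k"

lemma lookup_expo [simp]:
  "lookup (expo i j k) 0 = i" "lookup (expo i j k) 1 = j" "lookup (expo i j k) 2 = k"
  by (simp_all add: expo_def lookup_add lookup_single)

lemma expo_lookup: "expo (lookup e 0) (lookup e 1) (lookup e 2) = e"
proof (rule poly_mapping_eqI)
  fix i show "lookup (expo (lookup e 0) (lookup e 1) (lookup e 2)) i = lookup e i"
    using cases_3[of i] by auto
qed

lemma expo_eq_iff [simp]: "expo i j k = expo i' j' k' \<longleftrightarrow> i = i' \<and> j = j' \<and> k = k'"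
  by (metis lookup_expo)

lemma mono_degree_3: "mono_degree (e :: 3 \<Rightarrow>\<^sub>0 nat) = lookup e 0 + lookup e 1 + lookup e 2"
proof -
  have "mono_degree e = (\<Sum>i\<in>UNIV. lookup e i)"
    unfolding mono_degree_def by (rule sum.mono_neutral_left) (auto simp: in_keys_iff)
  then show ?thesis by (simp add: sum_3')
qed

lemma expo_in_cubic_exponents [simp]: "expo i j k \<in> cubic_exponents \<longleftrightarrow> i + j + k = 3"
  by (simp add: cubic_exponents_def mono_degree_3)

lemma degree_3_cases:
  assumes "i + j + k = (3::nat)"
  shows "(i, j, k) \<in> {(3,0,0), (2,1,0), (2,0,1), (1,2,0), (1,1,1), (1,0,2), (0,3,0), (0,2,1), (0,1,2), (0,0,3)}"
proof -
  have i: "i = 0 \<or> i = 1 \<or> i = 2 \<or> i = 3" and j: "j = 0 \<or> j = 1 \<or> j = 2 \<or> j = 3"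
    and k: "k = 3 - i - j" and le: "i + j \<le> 3"
    using assms by linarith+
  show ?thesis
    using i j le unfolding k by (elim disjE) simp_all
qed

lemma cubic_exponents_eq: "cubic_exponents =
  {expo 3 0 0, expo 2 1 0, expo 2 0 1, expo 1 2 0, expo 1 1 1, expo 1 0 2, expo 0 3 0, expo 0 2 1, expo 0 1 2, expo 0 0 3}"
  (is "_ = ?R")
proof
  show "cubic_exponents \<subseteq> ?R"
  proof
    fix e assume "e \<in> cubic_exponents"
    then have "lookup e 0 + lookup e 1 + lookup e 2 = 3"
      by (simp add: cubic_exponents_def mono_degree_3)
    from degree_3_cases[OF this] show "e \<in> ?R"
      using expo_lookup[of e] by auto
  qed
qed auto

lemma finite_cubic_exponents [simp]: "finite cubic_exponents"
  by (simp add: cubic_exponents_eq)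

lemma sum_cubic_exponents: "(\<Sum>e\<in>cubic_exponents. h e) =
  h (expo 3 0 0) + h (expo 2 1 0) + h (expo 2 0 1) + h (expo 1 2 0) + h (expo 1 1 1) + h (expo 1 0 2) +
  h (expo 0 3 0) + h (expo 0 2 1) + h (expo 0 1 2) + h (expo 0 0 3)"
  by (simp add: cubic_exponents_eq add.assoc)

type_synonym coeffs = "nat \<Rightarrow> nat \<Rightarrow> nat \<Rightarrow> complex"

text \<open>The value of a cubic form and those of its partial derivatives that are needed; \<open>d1\<close> is the
derivative with respect to \<open>x\<^sub>1\<close>, and \<open>d12\<close> the one with respect to \<open>x\<^sub>1\<close> and \<open>x\<^sub>2\<close>.\<close>

definition cubic :: "coeffs \<Rightarrow> (3 \<Rightarrow> complex) \<Rightarrow> complex" where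
  "cubic a v = a 3 0 0 * v 0^3 + a 2 1 0 * v 0^2 * v 1 + a 2 0 1 * v 0^2 * v 2 + a 1 2 0 * v 0 * v 1^2 +
     a 1 1 1 * v 0 * v 1 * v 2 + a 1 0 2 * v 0 * v 2^2 + a 0 3 0 * v 1^3 + a 0 2 1 * v 1^2 * v 2 +
     a 0 1 2 * v 1 * v 2^2 + a 0 0 3 * v 2^3"

definition d1 :: "coeffs \<Rightarrow> (3 \<Rightarrow> complex) \<Rightarrow> complex" where
  "d1 a v = a 2 1 0 * v 0^2 + 2 * a 1 2 0 * v 0 * v 1 + a 1 1 1 * v 0 * v 2 + 3 * a 0 3 0 * v 1^2 +
     2 * a 0 2 1 * v 1 * v 2 + a 0 1 2 * v 2^2"

definition d2 :: "coeffs \<Rightarrow> (3 \<Rightarrow> complex) \<Rightarrow> complex" where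
  "d2 a v = a 2 0 1 * v 0^2 + a 1 1 1 * v 0 * v 1 + 2 * a 1 0 2 * v 0 * v 2 + a 0 2 1 * v 1^2 +
     2 * a 0 1 2 * v 1 * v 2 + 3 * a 0 0 3 * v 2^2"

definition d00 :: "coeffs \<Rightarrow> (3 \<Rightarrow> complex) \<Rightarrow> complex" where
  "d00 a v = 6 * a 3 0 0 * v 0 + 2 * a 2 1 0 * v 1 + 2 * a 2 0 1 * v 2"

definition d01 :: "coeffs \<Rightarrow> (3 \<Rightarrow> complex) \<Rightarrow> complex" where
  "d01 a v = 2 * a 2 1 0 * v 0 + 2 * a 1 2 0 * v 1 + a 1 1 1 * v 2"

definition d02 :: "coeffs \<Rightarrow> (3 \<Rightarrow> complex) \<Rightarrow> complex" where
  "d02 a v = 2 * a 2 0 1 * v 0 + a 1 1 1 * v 1 + 2 * a 1 0 2 * v 2"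

definition d11 :: "coeffs \<Rightarrow> (3 \<Rightarrow> complex) \<Rightarrow> complex" where
  "d11 a v = 2 * a 1 2 0 * v 0 + 6 * a 0 3 0 * v 1 + 2 * a 0 2 1 * v 2"

definition d12 :: "coeffs \<Rightarrow> (3 \<Rightarrow> complex) \<Rightarrow> complex" where
  "d12 a v = a 1 1 1 * v 0 + 2 * a 0 2 1 * v 1 + 2 * a 0 1 2 * v 2"

definition d22 :: "coeffs \<Rightarrow> (3 \<Rightarrow> complex) \<Rightarrow> complex" where
  "d22 a v = 2 * a 1 0 2 * v 0 + 2 * a 0 1 2 * v 1 + 6 * a 0 0 3 * v 2"

lemmas d_defs = d00_def d01_def d02_def d11_def d12_def d22_def

definition hessian :: "coeffs \<Rightarrow> (3 \<Rightarrow> complex) \<Rightarrow> complex" where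
  "hessian a v = d00 a v * d11 a v * d22 a v + 2 * d01 a v * d02 a v * d12 a v
     - d00 a v * d12 a v ^ 2 - d11 a v * d02 a v ^ 2 - d22 a v * d01 a v ^ 2"

definition coeffs_of :: "((3 \<Rightarrow>\<^sub>0 nat) \<Rightarrow> complex) \<Rightarrow> coeffs" where
  "coeffs_of \<alpha> i j k = \<alpha> (expo i j k)"

text \<open>The monomial \<open>\<alpha>\<^sub>e x\<^sup>e\<close> of the universal cubic form.\<close>

definition gen_mono :: "(3 \<Rightarrow>\<^sub>0 nat) \<Rightarrow> ((3 \<Rightarrow>\<^sub>0 nat) + 3 \<Rightarrow>\<^sub>0 nat)" where
  "gen_mono e = single (Inl e) 1 + (\<Sum>i\<in>UNIV. single (Inr i) (lookup e i))"

lemma lookup_gen_mono [simp]: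
  "lookup (gen_mono e) (Inr i) = lookup e i" "lookup (gen_mono e) (Inl e') = (if e = e' then 1 else 0)"
  by (auto simp: gen_mono_def lookup_add lookup_sum lookup_single when_def)

lemma F_form_eq: "F_form = (\<Sum>e\<in>cubic_exponents. single (gen_mono e) 1)"
proof -
  have pow: "single (single i 1) (1::complex) ^ n = single (single i n) 1" for i :: "(3 \<Rightarrow>\<^sub>0 nat) + 3" and n
    by (induction n) (simp_all add: mult_single single_add[symmetric])
  have pr: "(\<Prod>i\<in>A. single (f i) (1::complex)) = single (\<Sum>i\<in>A. f i) 1"
    for A :: "3 set" and f :: "3 \<Rightarrow> ((3 \<Rightarrow>\<^sub>0 nat) + 3 \<Rightarrow>\<^sub>0 nat)"
    by (induction A rule: infinite_finite_induct) (simp_all add: mult_single)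
  show ?thesis
    unfolding F_form_def indet_def pow pr mult_single gen_mono_def by simp
qed

lemma eval_gen_mono:
  fixes m :: "'i + 3 \<Rightarrow>\<^sub>0 nat"
  assumes "\<And>e'. lookup m (Inl e') = (if e = e' then 1 else 0)"
  shows "eval_mono (case_sum \<alpha> v) m =
    \<alpha> e * (v 0 ^ lookup m (Inr 0) * v 1 ^ lookup m (Inr 1) * v 2 ^ lookup m (Inr 2))"
proof -
  have "keys m \<subseteq> insert (Inl e) (range Inr)"
  proof
    fix k assume k: "k \<in> keys m"
    then show "k \<in> insert (Inl e) (range Inr)"
      using assms by (cases k) (auto simp: in_keys_iff split: if_splits)
  qed
  then have "eval_mono (case_sum \<alpha> v) m = (\<Prod>k\<in>insert (Inl e) (range Inr). case_sum \<alpha> v k ^ lookup m k)"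
    by (intro eval_mono_superset finite.insertI finite_imageI finite)
  also have "\<dots> = \<alpha> e * (\<Prod>i\<in>UNIV. v i ^ lookup m (Inr i))"
    using assms by (subst prod.insert) (auto simp: prod.reindex finite_imageI[OF finite])
  finally show ?thesis by (simp only: prod_3')
qed

lemma eval_F_form: "eval_poly (case_sum \<alpha> v) F_form = cubic (coeffs_of \<alpha>) v"
  unfolding F_form_eq eval_poly_sum
  by (simp add: eval_gen_mono sum_cubic_exponents cubic_def coeffs_of_def mult.assoc)

lemma partial_deriv_superset:
  assumes "finite K" "keys P \<subseteq> K"
  shows "partial_deriv i P = (\<Sum>m\<in>K. single (m - single i 1) (lookup P m * of_nat (lookup m i)))"
  unfolding partial_deriv_def
  by (rule sum.mono_neutral_left) (use assms in \<open>auto simp: in_keys_iff\<close>)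

lemma partial_deriv_add: "partial_deriv i (P + Q) = partial_deriv i P + partial_deriv i Q"
proof -
  have *: "partial_deriv i R =
      (\<Sum>m\<in>keys P \<union> keys Q. single (m - single i 1) (lookup R m * of_nat (lookup m i)))"
    if "keys R \<subseteq> keys P \<union> keys Q" for R
    using that by (intro partial_deriv_superset) auto
  show ?thesis
    unfolding *[OF keys_add] *[OF Un_upper1] *[OF Un_upper2]
    by (simp add: lookup_add distrib_right single_add sum.distrib)
qed

lemma partial_deriv_single:
  "partial_deriv i (single m c) = single (m - single i 1) (c * of_nat (lookup m i))"
  by (simp add: partial_deriv_def)

lemma partial_deriv_sum: "partial_deriv i (sum P A) = (\<Sum>a\<in>A. partial_deriv i (P a))"
proof -
  have "partial_deriv i 0 = 0" by (simp add: partial_deriv_def)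
  then show ?thesis
    by (induction A rule: infinite_finite_induct) (auto simp: partial_deriv_add)
qed

lemma eval_second_derivs:
  defines "D i j \<equiv> \<lambda>\<alpha> v. eval_poly (case_sum \<alpha> v) (partial_deriv (Inr i) (partial_deriv (Inr j) F_form))"
  shows "D 0 0 \<alpha> v = d00 (coeffs_of \<alpha>) v" "D 0 1 \<alpha> v = d01 (coeffs_of \<alpha>) v" "D 0 2 \<alpha> v = d02 (coeffs_of \<alpha>) v"
    "D 1 0 \<alpha> v = d01 (coeffs_of \<alpha>) v" "D 1 1 \<alpha> v = d11 (coeffs_of \<alpha>) v" "D 1 2 \<alpha> v = d12 (coeffs_of \<alpha>) v"
    "D 2 0 \<alpha> v = d02 (coeffs_of \<alpha>) v" "D 2 1 \<alpha> v = d12 (coeffs_of \<alpha>) v" "D 2 2 \<alpha> v = d22 (coeffs_of \<alpha>) v"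
proof -
  have D: "D i j \<alpha> v = (\<Sum>e\<in>cubic_exponents. of_nat (lookup e j) * of_nat (lookup e i - (if i = j then 1 else 0)) *
      (\<alpha> e * (v 0 ^ (lookup e 0 - (if j = 0 then 1 else 0) - (if i = 0 then 1 else 0)) *
              v 1 ^ (lookup e 1 - (if j = 1 then 1 else 0) - (if i = 1 then 1 else 0)) *
              v 2 ^ (lookup e 2 - (if j = 2 then 1 else 0) - (if i = 2 then 1 else 0)))))" for i j
    unfolding D_def F_form_eq partial_deriv_sum eval_poly_sum partial_deriv_single eval_poly_single
    by (intro sum.cong refl, subst eval_gen_mono)
       (auto simp: lookup_minus lookup_single when_def)
  show "D 0 0 \<alpha> v = d00 (coeffs_of \<alpha>) v" "D 0 1 \<alpha> v = d01 (coeffs_of \<alpha>) v" "D 0 2 \<alpha> v = d02 (coeffs_of \<alpha>) v"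
    "D 1 0 \<alpha> v = d01 (coeffs_of \<alpha>) v" "D 1 1 \<alpha> v = d11 (coeffs_of \<alpha>) v" "D 1 2 \<alpha> v = d12 (coeffs_of \<alpha>) v"
    "D 2 0 \<alpha> v = d02 (coeffs_of \<alpha>) v" "D 2 1 \<alpha> v = d12 (coeffs_of \<alpha>) v" "D 2 2 \<alpha> v = d22 (coeffs_of \<alpha>) v"
    by (simp_all add: D sum_cubic_exponents d_defs coeffs_of_def)
qed

lemma eval_H_form: "eval_poly (case_sum \<alpha> v) H_form = hessian (coeffs_of \<alpha>) v"
  unfolding H_form_def det_3
  by (simp add: eval_poly_add eval_poly_diff eval_poly_mult eval_second_derivs hessian_def)
     (simp add: algebra_simps power2_eq_square)


section \<open>Cubics with a flex at a given point\<close>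

text \<open>The coefficients of the product of the linear form \<open>l\<^sub>0 x\<^sub>0 + l\<^sub>1 x\<^sub>1 + l\<^sub>2 x\<^sub>2\<close> with the form with
coefficients \<open>q\<close>, of any degree; iterated from the constant form 1 it gives products of linear forms.\<close>

definition mult_lin :: "(3 \<Rightarrow> complex) \<Rightarrow> coeffs \<Rightarrow> coeffs" where
  "mult_lin l q i j k = (if i = 0 then 0 else l 0 * q (i - 1) j k) +
     (if j = 0 then 0 else l 1 * q i (j - 1) k) + (if k = 0 then 0 else l 2 * q i j (k - 1))"

definition unit_coeffs :: coeffs where
  "unit_coeffs i j k = (if i = 0 \<and> j = 0 \<and> k = 0 then 1 else 0)"

definition vanishes_at :: "(3 \<Rightarrow> complex) \<Rightarrow> (3 \<Rightarrow> complex) \<Rightarrow> bool" where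
  "vanishes_at l v \<longleftrightarrow> l 0 * v 0 + l 1 * v 1 + l 2 * v 2 = 0"

text \<open>The cubic \<open>l q + m n\<^sup>2 + m' n'\<^sup>2\<close>. Two summands of the shape \<open>m n\<^sup>2\<close> suffice to represent every
binary cubic, since \<open>c\<^sub>0 y\<^sub>1\<^sup>3 + c\<^sub>1 y\<^sub>1\<^sup>2 y\<^sub>2 + c\<^sub>2 y\<^sub>1 y\<^sub>2\<^sup>2 + c\<^sub>3 y\<^sub>2\<^sup>3\<close> is
\<open>(c\<^sub>0 y\<^sub>1 + c\<^sub>1 y\<^sub>2) y\<^sub>1\<^sup>2 + (c\<^sub>2 y\<^sub>1 + c\<^sub>3 y\<^sub>2) y\<^sub>2\<^sup>2\<close>; in this way no binary cubic has to be
factored.\<close>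

definition flex_coeffs where
  "flex_coeffs l q n m n' m' i j k = mult_lin l q i j k +
     mult_lin m (mult_lin n (mult_lin n unit_coeffs)) i j k +
     mult_lin m' (mult_lin n' (mult_lin n' unit_coeffs)) i j k"

text \<open>The product rule at a point where the linear factor vanishes: the Hessian matrix is
\<open>l g\<^sup>T + g l\<^sup>T\<close>, where \<open>g\<close> is the gradient of the other factor. In particular it has rank at most 2.\<close>

lemma second_derivs_mult_lin:
  assumes "vanishes_at l v"
  defines "g0 \<equiv> \<lambda>q. 2 * q 2 0 0 * v 0 + q 1 1 0 * v 1 + q 1 0 1 * v 2"
    and "g1 \<equiv> \<lambda>q. q 1 1 0 * v 0 + 2 * q 0 2 0 * v 1 + q 0 1 1 * v 2"
    and "g2 \<equiv> \<lambda>q. q 1 0 1 * v 0 + q 0 1 1 * v 1 + 2 * q 0 0 2 * v 2"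
  shows "d00 (mult_lin l q) v = 2 * l 0 * g0 q" "d01 (mult_lin l q) v = l 0 * g1 q + l 1 * g0 q"
    "d02 (mult_lin l q) v = l 0 * g2 q + l 2 * g0 q" "d11 (mult_lin l q) v = 2 * l 1 * g1 q"
    "d12 (mult_lin l q) v = l 1 * g2 q + l 2 * g1 q" "d22 (mult_lin l q) v = 2 * l 2 * g2 q"
    "cubic (mult_lin l q) v = 0"
proof -
  have l: "l 0 * v 0 + l 1 * v 1 + l 2 * v 2 = 0" using assms by (simp add: vanishes_at_def)
  show "d00 (mult_lin l q) v = 2 * l 0 * g0 q" "d01 (mult_lin l q) v = l 0 * g1 q + l 1 * g0 q"
    "d02 (mult_lin l q) v = l 0 * g2 q + l 2 * g0 q" "d11 (mult_lin l q) v = 2 * l 1 * g1 q"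
    "d12 (mult_lin l q) v = l 1 * g2 q + l 2 * g1 q" "d22 (mult_lin l q) v = 2 * l 2 * g2 q"
    unfolding g0_def g1_def g2_def d_defs mult_lin_def
    by (simp_all, (use l in algebra)+)
  show "cubic (mult_lin l q) v = 0"
    unfolding cubic_def mult_lin_def by (simp, use l in algebra)
qed

text \<open>The terms \<open>m n\<^sup>2\<close> vanish to third order at \<open>v\<close> and do not contribute to the second derivatives there;
the contribution of \<open>l q\<close> is a matrix of rank at most 2.\<close>

lemma flex_coeffs_flex:
  assumes "vanishes_at l v" "vanishes_at n v" "vanishes_at m v" "vanishes_at n' v" "vanishes_at m' v"
  shows "cubic (flex_coeffs l q n m n' m') v = 0" "hessian (flex_coeffs l q n m n' m') v = 0"
proof -
  define g0 where "g0 = 2 * q 2 0 0 * v 0 + q 1 1 0 * v 1 + q 1 0 1 * v 2"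
  define g1 where "g1 = q 1 1 0 * v 0 + 2 * q 0 2 0 * v 1 + q 0 1 1 * v 2"
  define g2 where "g2 = q 1 0 1 * v 0 + q 0 1 1 * v 1 + 2 * q 0 0 2 * v 2"
  have triple: "d00 (mult_lin m (mult_lin n (mult_lin n unit_coeffs))) v = 0"
     "d01 (mult_lin m (mult_lin n (mult_lin n unit_coeffs))) v = 0"
     "d02 (mult_lin m (mult_lin n (mult_lin n unit_coeffs))) v = 0"
     "d11 (mult_lin m (mult_lin n (mult_lin n unit_coeffs))) v = 0"
     "d12 (mult_lin m (mult_lin n (mult_lin n unit_coeffs))) v = 0"
     "d22 (mult_lin m (mult_lin n (mult_lin n unit_coeffs))) v = 0"
    if m: "vanishes_at m v" and n: "vanishes_at n v" for m n
  proof -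
    define q where "q = mult_lin n (mult_lin n unit_coeffs)"
    have "2 * q 2 0 0 * v 0 + q 1 1 0 * v 1 + q 1 0 1 * v 2 = 0"
      "q 1 1 0 * v 0 + 2 * q 0 2 0 * v 1 + q 0 1 1 * v 2 = 0"
      "q 1 0 1 * v 0 + q 0 1 1 * v 1 + 2 * q 0 0 2 * v 2 = 0"
      unfolding q_def mult_lin_def unit_coeffs_def
      by (simp_all, (use n[unfolded vanishes_at_def] in algebra)+)
    then show "d00 (mult_lin m (mult_lin n (mult_lin n unit_coeffs))) v = 0"
     "d01 (mult_lin m (mult_lin n (mult_lin n unit_coeffs))) v = 0"
     "d02 (mult_lin m (mult_lin n (mult_lin n unit_coeffs))) v = 0"
     "d11 (mult_lin m (mult_lin n (mult_lin n unit_coeffs))) v = 0"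
     "d12 (mult_lin m (mult_lin n (mult_lin n unit_coeffs))) v = 0"
     "d22 (mult_lin m (mult_lin n (mult_lin n unit_coeffs))) v = 0"
      unfolding q_def[symmetric] second_derivs_mult_lin[OF m] by simp_all
  qed
  have add: "D (\<lambda>i j k. a i j k + b i j k + c i j k) v = D a v + D b v + D c v"
    if "D \<in> {d00, d01, d02, d11, d12, d22, cubic}" for D and a b c :: coeffs
    using that by (elim insertE emptyE) (simp_all add: d_defs cubic_def algebra_simps)
  let ?F = "flex_coeffs l q n m n' m'"
  have F: "?F = (\<lambda>i j k. mult_lin l q i j k + mult_lin m (mult_lin n (mult_lin n unit_coeffs)) i j k +
     mult_lin m' (mult_lin n' (mult_lin n' unit_coeffs)) i j k)"
    by (simp add: flex_coeffs_def fun_eq_iff)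
  show "cubic ?F v = 0"
    unfolding F by (simp add: add second_derivs_mult_lin(7) assms)
  \<comment> \<open>The vector \<open>(g0, g1, g2)\<close> is the gradient of \<open>q\<close> at \<open>v\<close>.\<close>
  have dd: "d00 ?F v = 2 * l 0 * g0" "d01 ?F v = l 0 * g1 + l 1 * g0" "d02 ?F v = l 0 * g2 + l 2 * g0"
    "d11 ?F v = 2 * l 1 * g1" "d12 ?F v = l 1 * g2 + l 2 * g1" "d22 ?F v = 2 * l 2 * g2"
    unfolding F by (simp_all add: add triple assms second_derivs_mult_lin[OF assms(1)] g0_def g1_def g2_def)
  show "hessian ?F v = 0"
    unfolding hessian_def dd by algebra
qed

text \<open>Adding to the first row and column of the Hessian matrix, multiplied by \<open>v\<^sub>0\<close>, the multiples of the other
ones by \<open>v\<^sub>1\<close> and \<open>v\<^sub>2\<close> turns it, by Euler's relations, into a matrix bordered by the first derivatives, with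
corner entry a multiple of the value of the cubic, that is, 0.\<close>

lemma hessian_at_zero:
  assumes "cubic a v = 0"
  shows "v 0 ^ 2 * hessian a v =
    - 4 * (d1 a v ^ 2 * d22 a v - 2 * d1 a v * d2 a v * d12 a v + d2 a v ^ 2 * d11 a v)"
proof -
  define d0 where "d0 = 3 * a 3 0 0 * v 0^2 + 2 * a 2 1 0 * v 0 * v 1 + 2 * a 2 0 1 * v 0 * v 2 +
    a 1 2 0 * v 1^2 + a 1 1 1 * v 1 * v 2 + a 1 0 2 * v 2^2"
  have e: "v 0 * d00 a v + v 1 * d01 a v + v 2 * d02 a v = 2 * d0"
    "v 0 * d01 a v + v 1 * d11 a v + v 2 * d12 a v = 2 * d1 a v"
    "v 0 * d02 a v + v 1 * d12 a v + v 2 * d22 a v = 2 * d2 a v"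
    unfolding d_defs d0_def d1_def d2_def by algebra+
  have "v 0 * d0 + v 1 * d1 a v + v 2 * d2 a v = 3 * cubic a v"
    unfolding d0_def d1_def d2_def cubic_def by algebra
  then have "v 0 * d0 + v 1 * d1 a v + v 2 * d2 a v = 0" using assms by simp
  with e show ?thesis unfolding hessian_def by algebra
qed

lemma flex_tangent_relation:
  assumes "cubic a v = 0" "hessian a v = 0"
  shows "d1 a v ^ 2 * d22 a v - 2 * d1 a v * d2 a v * d12 a v + d2 a v ^ 2 * d11 a v = 0"
proof -
  have "(-4) * (d1 a v ^ 2 * d22 a v - 2 * d1 a v * d2 a v * d12 a v + d2 a v ^ 2 * d11 a v) = 0"
    using hessian_at_zero[OF assms(1)] assms(2) by (metis mult_zero_right)
  then show ?thesis
    by (metis mult_eq_0_iff neg_equal_0_iff_equal zero_neq_numeral)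
qed

text \<open>The Taylor expansion at \<open>v\<close>, where \<open>n\<close> and \<open>n'\<close> are the linear forms \<open>x\<^sub>1 - v\<^sub>1 x\<^sub>0\<close> and
\<open>x\<^sub>2 - v\<^sub>2 x\<^sub>0\<close>, and \<open>x\<close> is the form \<open>x\<^sub>0\<close>. The hypotheses say that the linear term is \<open>t\<close>
times \<open>l\<^sub>1 n + l\<^sub>2 n'\<close> and that the quadratic term is \<open>l\<^sub>1 n + l\<^sub>2 n'\<close> times \<open>M\<^sub>1 n + M\<^sub>2 n'\<close>.\<close>

lemma local_form:
  assumes v: "v 0 = 1" and F: "cubic a v = 0"
    and D: "d1 a v = t * l1" "d2 a v = t * l2"
    and DD: "d11 a v = 2 * l1 * M1" "d12 a v = l1 * M2 + l2 * M1" "d22 a v = 2 * l2 * M2"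
    and x: "x 0 = 1" "x 1 = 0" "x 2 = 0"
    and n: "n 0 = - v 1" "n 1 = 1" "n 2 = 0" and n': "n' 0 = - v 2" "n' 1 = 0" "n' 2 = 1"
    and ijk: "i + j + k = 3"
  shows "a i j k = flex_coeffs (\<lambda>r. l1 * n r + l2 * n' r)
     (mult_lin x (mult_lin (\<lambda>r. t * x r + M1 * n r + M2 * n' r) unit_coeffs))
     n (\<lambda>r. a 0 3 0 * n r + a 0 2 1 * n' r) n' (\<lambda>r. a 0 1 2 * n r + a 0 0 3 * n' r) i j k"
proof -
  \<comment> \<open>The values at \<open>v\<close> of the cubic and its derivatives determine the six coefficients of the
      monomials divisible by \<open>x\<^sub>0\<close>, by a triangular system of linear equations.\<close>
  have a120: "a 1 2 0 = l1 * M1 - 3 * a 0 3 0 * v 1 - a 0 2 1 * v 2"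
    using DD(1) v unfolding d11_def by algebra
  have a111: "a 1 1 1 = l1 * M2 + l2 * M1 - 2 * a 0 2 1 * v 1 - 2 * a 0 1 2 * v 2"
    using DD(2) v unfolding d12_def by algebra
  have a102: "a 1 0 2 = l2 * M2 - a 0 1 2 * v 1 - 3 * a 0 0 3 * v 2"
    using DD(3) v unfolding d22_def by algebra
  have a210: "a 2 1 0 = t * l1 - (2 * a 1 2 0 * v 1 + a 1 1 1 * v 2 + 3 * a 0 3 0 * v 1^2 +
     2 * a 0 2 1 * v 1 * v 2 + a 0 1 2 * v 2^2)"
    using D(1) v unfolding d1_def by algebra
  have a201: "a 2 0 1 = t * l2 - (a 1 1 1 * v 1 + 2 * a 1 0 2 * v 2 + a 0 2 1 * v 1^2 +
     2 * a 0 1 2 * v 1 * v 2 + 3 * a 0 0 3 * v 2^2)"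
    using D(2) v unfolding d2_def by algebra
  have a300: "a 3 0 0 = - (a 2 1 0 * v 1 + a 2 0 1 * v 2 + a 1 2 0 * v 1^2 +
     a 1 1 1 * v 1 * v 2 + a 1 0 2 * v 2^2 + a 0 3 0 * v 1^3 + a 0 2 1 * v 1^2 * v 2 +
     a 0 1 2 * v 1 * v 2^2 + a 0 0 3 * v 2^3)"
    using F v unfolding cubic_def by algebra
  note expand = a300 a210 a201 a120 a111 a102 flex_coeffs_def mult_lin_def unit_coeffs_def
  let ?b = "flex_coeffs (\<lambda>r. l1 * n r + l2 * n' r)
     (mult_lin x (mult_lin (\<lambda>r. t * x r + M1 * n r + M2 * n' r) unit_coeffs))
     n (\<lambda>r. a 0 3 0 * n r + a 0 2 1 * n' r) n' (\<lambda>r. a 0 1 2 * n r + a 0 0 3 * n' r)"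
  have b300: "a 3 0 0 = ?b 3 0 0"
    unfolding expand by (simp add: x n n'; algebra)
  have b210: "a 2 1 0 = ?b 2 1 0"
    unfolding expand by (simp add: x n n'; algebra)
  have b201: "a 2 0 1 = ?b 2 0 1"
    unfolding expand by (simp add: x n n'; algebra)
  have b120: "a 1 2 0 = ?b 1 2 0"
    unfolding expand by (simp add: x n n'; algebra)
  have b111: "a 1 1 1 = ?b 1 1 1"
    unfolding expand by (simp add: x n n'; algebra)
  have b102: "a 1 0 2 = ?b 1 0 2"
    unfolding expand by (simp add: x n n'; algebra)
  have b030: "a 0 3 0 = ?b 0 3 0"
    unfolding flex_coeffs_def mult_lin_def unit_coeffs_def by (simp add: x n n')
  have b021: "a 0 2 1 = ?b 0 2 1"
    unfolding flex_coeffs_def mult_lin_def unit_coeffs_def by (simp add: x n n')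
  have b012: "a 0 1 2 = ?b 0 1 2"
    unfolding flex_coeffs_def mult_lin_def unit_coeffs_def by (simp add: x n n')
  have b003: "a 0 0 3 = ?b 0 0 3"
    unfolding flex_coeffs_def mult_lin_def unit_coeffs_def by (simp add: x n n')
  show ?thesis
    using degree_3_cases[OF ijk] b300 b210 b201 b120 b111 b102 b030 b021 b012 b003
    by (elim insertE emptyE Pair_inject) (simp_all only:)
qed

text \<open>If the linear form \<open>A y\<^sub>1 + B y\<^sub>2\<close> is not zero and the quadratic form
\<open>(Q y\<^sub>1\<^sup>2 + 2 S y\<^sub>1 y\<^sub>2 + R y\<^sub>2\<^sup>2) / 2\<close> vanishes at its zero \<open>(B, - A)\<close>, then it
divides the quadratic form. If it is zero, then \<open>t = 0\<close>, and any linear factor of the quadratic form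
will do.\<close>

lemma tangent_conic_split:
  fixes A B :: complex
  assumes "A^2 * R - 2 * A * B * S + B^2 * Q = 0"
  shows "\<exists>t l1 l2 M1 M2. A = t * l1 \<and> B = t * l2 \<and> Q = 2 * l1 * M1 \<and> S = l1 * M2 + l2 * M1 \<and> R = 2 * l2 * M2"
proof -
  consider "A \<noteq> 0" | "A = 0" "B \<noteq> 0" | "A = 0" "B = 0" "Q \<noteq> 0" | "A = 0" "B = 0" "Q = 0" by blast
  then show ?thesis
  proof cases
    case 1
    have "R = 2 * B * ((S - B * (Q / (2 * A))) / A)"
      using 1 assms by (simp add: field_simps power2_eq_square) algebra
    then show ?thesis
      using 1 by (intro exI[of _ 1] exI[of _ A] exI[of _ B] exI[of _ "Q / (2 * A)"]
          exI[of _ "(S - B * (Q / (2 * A))) / A"]) (simp add: field_simps)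
  next
    case 2
    then have "Q = 0" using assms by simp
    then show ?thesis
      using 2 by (intro exI[of _ 1] exI[of _ A] exI[of _ B] exI[of _ "S / B"] exI[of _ "R / (2 * B)"]) simp
  next
    case 3
    define r where "r = csqrt (S^2 - Q * R)"
    have r: "r ^ 2 = S^2 - Q * R" by (simp add: r_def)
    have "R = 2 * ((S + r) / 2) * ((S - r) / Q)"
      using 3 r by (simp add: field_simps power2_eq_square; algebra)
    then show ?thesis
      using 3 by (intro exI[of _ 0] exI[of _ "Q / 2"] exI[of _ "(S + r) / 2"] exI[of _ 1]
          exI[of _ "(S - r) / Q"]) (simp add: field_simps)
  next
    case 4
    then show ?thesis
      by (intro exI[of _ 0] exI[of _ 0] exI[of _ 1] exI[of _ S] exI[of _ "R / 2"]) simp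
  qed
qed

text \<open>The normal form of \<open>local_form\<close> refers to the coordinate \<open>x\<^sub>0\<close>. This description does not, so it
can be established where \<open>v\<^sub>0 \<noteq> 0\<close> and transported to all points by permuting the coordinates.\<close>

definition is_flex_form :: "coeffs \<Rightarrow> (3 \<Rightarrow> complex) \<Rightarrow> bool" where
  "is_flex_form a v \<longleftrightarrow> (\<exists>l q n m n' m'. vanishes_at l v \<and> vanishes_at n v \<and> vanishes_at m v \<and>
     vanishes_at n' v \<and> vanishes_at m' v \<and>
     (\<forall>i j k. i + j + k = 3 \<longrightarrow> a i j k = flex_coeffs l q n m n' m' i j k))"

lemma flex_form_normalized:
  assumes v: "v 0 = 1" and F: "cubic a v = 0" and H: "hessian a v = 0"
  shows "is_flex_form a v"
proof -
  obtain t l1 l2 M1 M2 where D: "d1 a v = t * l1" "d2 a v = t * l2"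
    "d11 a v = 2 * l1 * M1" "d12 a v = l1 * M2 + l2 * M1" "d22 a v = 2 * l2 * M2"
    using tangent_conic_split[OF flex_tangent_relation[OF F H]] by blast
  define x :: "3 \<Rightarrow> complex" where "x r = (if r = 0 then 1 else 0)" for r
  define n :: "3 \<Rightarrow> complex" where "n r = (if r = 0 then - v 1 else if r = 1 then 1 else 0)" for r
  define n' :: "3 \<Rightarrow> complex" where "n' r = (if r = 0 then - v 2 else if r = 2 then 1 else 0)" for r
  have van: "vanishes_at (\<lambda>r. b * n r + c * n' r) v" "vanishes_at n v" "vanishes_at n' v" for b c
    using v by (simp_all add: vanishes_at_def n_def n'_def algebra_simps)
  have "a i j k = flex_coeffs (\<lambda>r. l1 * n r + l2 * n' r)
     (mult_lin x (mult_lin (\<lambda>r. t * x r + M1 * n r + M2 * n' r) unit_coeffs))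
     n (\<lambda>r. a 0 3 0 * n r + a 0 2 1 * n' r) n' (\<lambda>r. a 0 1 2 * n r + a 0 0 3 * n' r) i j k"
    if "i + j + k = 3" for i j k
    by (rule local_form[OF v F D]) (simp_all add: x_def n_def n'_def that)
  then show ?thesis
    unfolding is_flex_form_def using van by blast
qed

lemma cubic_scale: "cubic a (\<lambda>i. c * v i) = c^3 * cubic a v"
  unfolding cubic_def by algebra

lemma hessian_scale: "hessian a (\<lambda>i. c * v i) = c^3 * hessian a v"
  unfolding hessian_def d_defs by algebra

lemma flex_form_chart:
  assumes v: "v 0 \<noteq> 0" and F: "cubic a v = 0" and H: "hessian a v = 0"
  shows "is_flex_form a v"
proof -
  define w where "w = (\<lambda>i. inverse (v 0) * v i)"
  have "is_flex_form a w"
    using v F H unfolding w_def by (intro flex_form_normalized) (auto simp: cubic_scale hessian_scale)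
  moreover have "vanishes_at l w \<longleftrightarrow> vanishes_at l v" for l
    using v by (auto simp: vanishes_at_def w_def field_simps)
  ultimately show ?thesis by (simp add: is_flex_form_def)
qed

text \<open>The powers of the cyclic permutation of the coordinates move any of them to the position 0.\<close>

definition rot :: "(3 \<Rightarrow> complex) \<Rightarrow> (3 \<Rightarrow> complex)" where
  "rot v i = v (i + 1)"

definition rot_coeffs :: "coeffs \<Rightarrow> coeffs" where
  "rot_coeffs a i j k = a k i j"

lemma rot_simps [simp]: "rot v 0 = v 1" "rot v 1 = v 2" "rot v 2 = v 0"
  by (simp_all add: rot_def)

lemma cubic_rot: "cubic (rot_coeffs a) (rot v) = cubic a v"
  by (simp add: cubic_def rot_coeffs_def algebra_simps)

lemma hessian_rot: "hessian (rot_coeffs a) (rot v) = hessian a v"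
proof -
  have "d00 (rot_coeffs a) (rot v) = d11 a v" "d01 (rot_coeffs a) (rot v) = d12 a v"
    "d02 (rot_coeffs a) (rot v) = d01 a v" "d11 (rot_coeffs a) (rot v) = d22 a v"
    "d12 (rot_coeffs a) (rot v) = d02 a v" "d22 (rot_coeffs a) (rot v) = d00 a v"
    by (simp_all add: d_defs rot_coeffs_def)
  then show ?thesis by (simp add: hessian_def algebra_simps)
qed

lemma flex_form_rot:
  assumes "is_flex_form (rot_coeffs a) (rot v)"
  shows "is_flex_form a v"
proof -
  have rot_ex: "\<exists>l'. l = rot l'" for l
  proof
    show "l = rot (\<lambda>i. l (i - 1))" by (simp add: rot_def fun_eq_iff)
  qed
  have mult_rot: "mult_lin (rot l) (rot_coeffs q) = rot_coeffs (mult_lin l q)" for l q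
    by (simp add: fun_eq_iff mult_lin_def rot_coeffs_def)
  have rot_coeffs_ex: "\<exists>q'. q = rot_coeffs q'" for q
    by (intro exI[of _ "\<lambda>i j k. q j k i"]) (simp add: rot_coeffs_def fun_eq_iff)
  have unit: "unit_coeffs = rot_coeffs unit_coeffs"
    by (auto simp: unit_coeffs_def rot_coeffs_def fun_eq_iff)
  have van: "vanishes_at (rot l) (rot v) \<longleftrightarrow> vanishes_at l v" for l
    by (simp add: vanishes_at_def algebra_simps)
  obtain l q n m n' m' where fl: "vanishes_at l (rot v)" "vanishes_at n (rot v)" "vanishes_at m (rot v)"
    "vanishes_at n' (rot v)" "vanishes_at m' (rot v)"
    and eq: "\<And>i j k. i + j + k = 3 \<Longrightarrow> rot_coeffs a i j k = flex_coeffs l q n m n' m' i j k"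
    using assms unfolding is_flex_form_def by blast
  obtain l0 q0 n0 m0 n0' m0' where r: "l = rot l0" "q = rot_coeffs q0" "n = rot n0" "m = rot m0"
    "n' = rot n0'" "m' = rot m0'"
    using rot_ex rot_coeffs_ex by metis
  have "flex_coeffs l q n m n' m' i j k = rot_coeffs (flex_coeffs l0 q0 n0 m0 n0' m0') i j k" for i j k
    unfolding flex_coeffs_def r
    by (subst (1 2) unit) (simp only: mult_rot, simp add: rot_coeffs_def flex_coeffs_def)
  then have "a k i j = flex_coeffs l0 q0 n0 m0 n0' m0' k i j" if "k + i + j = 3" for i j k
    using eq[of i j k] that by (simp add: rot_coeffs_def)
  then show ?thesis
    using fl unfolding r van is_flex_form_def by blast
qed

lemma flex_form:
  assumes "v \<noteq> (\<lambda>_. 0)" and FH: "cubic a v = 0" "hessian a v = 0"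
  shows "is_flex_form a v"
proof -
  have "v 0 \<noteq> 0 \<or> rot v 0 \<noteq> 0 \<or> rot (rot v) 0 \<noteq> 0"
  proof -
    obtain i where "v i \<noteq> 0" using assms(1) by auto
    then show ?thesis using cases_3[of i] by auto
  qed
  then show ?thesis
    using flex_form_chart[of v a] flex_form_chart[of "rot v" "rot_coeffs a"]
      flex_form_chart[of "rot (rot v)" "rot_coeffs (rot_coeffs a)"] FH flex_form_rot
    by (auto simp: cubic_rot hessian_rot)
qed

text \<open>The linear form \<open>x \<mapsto> det (v, u, x)\<close>. These forms parametrize the linear forms vanishing at \<open>v\<close>
polynomially in \<open>v\<close>, for all \<open>v \<noteq> 0\<close> at once.\<close>

definition cross :: "(3 \<Rightarrow> complex) \<Rightarrow> (3 \<Rightarrow> complex) \<Rightarrow> (3 \<Rightarrow> complex)" where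
  "cross v u i = (if i = 0 then v 1 * u 2 - v 2 * u 1
     else if i = 1 then v 2 * u 0 - v 0 * u 2 else v 0 * u 1 - v 1 * u 0)"

lemma cross_simps: "cross v u 0 = v 1 * u 2 - v 2 * u 1" "cross v u 1 = v 2 * u 0 - v 0 * u 2"
  "cross v u 2 = v 0 * u 1 - v 1 * u 0"
  by (simp_all add: cross_def)

lemma vanishes_at_cross: "vanishes_at (cross v u) v"
  by (simp add: vanishes_at_def cross_simps algebra_simps)

lemma vanishes_at_imp_cross:
  assumes "v \<noteq> (\<lambda>_. 0)" "vanishes_at l v"
  shows "\<exists>u. l = cross v u"
proof -
  have crossI: "\<exists>u. l = cross v u" if "l 0 = cross v u 0" "l 1 = cross v u 1" "l 2 = cross v u 2" for u
  proof (intro exI ext)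
    show "l i = cross v u i" for i using that cases_3[of i] by auto
  qed
  have l: "l 0 * v 0 + l 1 * v 1 + l 2 * v 2 = 0" using assms(2) by (simp add: vanishes_at_def)
  obtain i where "v i \<noteq> 0" using assms(1) by auto
  then consider "v 0 \<noteq> 0" | "v 1 \<noteq> 0" | "v 2 \<noteq> 0" using cases_3 by metis
  then show ?thesis
  proof cases
    case 1
    then show ?thesis
      using l by (intro crossI[of "(\<lambda>i. if i = 0 then 0 else if i = 1 then l 2 / v 0 else - l 1 / v 0)"]) (simp add: cross_simps field_simps; algebra)+
  next
    case 2
    then show ?thesis
      using l by (intro crossI[of "(\<lambda>i. if i = 0 then - l 2 / v 1 else if i = 1 then 0 else l 0 / v 1)"]) (simp add: cross_simps field_simps; algebra)+
  next
    case 3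
    then show ?thesis
      using l by (intro crossI[of "(\<lambda>i. if i = 0 then l 1 / v 2 else if i = 1 then - l 0 / v 2 else 0)"]) (simp add: cross_simps field_simps; algebra)+
  qed
qed


section \<open>Irreducibility of the flex variety\<close>

lemma PU_times_PV_eq: "PU_times_PV = biproj.cspace cubic_exponents UNIV"
  by (simp add: PU_times_PV_def biprojectivization_eq)

lemma cubic_biscale: "cubic (coeffs_of (\<lambda>e. c * \<alpha> e)) (\<lambda>i. c' * x i) = c * c' ^ 3 * cubic (coeffs_of \<alpha>) x"
  unfolding cubic_def coeffs_of_def by algebra

lemma hessian_biscale:
  "hessian (coeffs_of (\<lambda>e. c * \<alpha> e)) (\<lambda>i. c' * x i) = c ^ 3 * c' ^ 3 * hessian (coeffs_of \<alpha>) x"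
  unfolding hessian_def d_defs coeffs_of_def by algebra

lemma flex_locusD:
  assumes "(L, M) \<in> flex_locus" "\<alpha> \<in> line_coords L" "x \<in> line_coords M"
  shows "cubic (coeffs_of \<alpha>) x = 0" "hessian (coeffs_of \<alpha>) x = 0"
proof -
  have "case_sum \<alpha> x \<in> pair_coords (L, M)" using assms by (auto simp: pair_coords_iff)
  then have "eval_poly (case_sum \<alpha> x) F_form = 0" "eval_poly (case_sum \<alpha> x) H_form = 0"
    using assms(1) by (auto simp: flex_locus_def)
  then show "cubic (coeffs_of \<alpha>) x = 0" "hessian (coeffs_of \<alpha>) x = 0"
    by (simp_all only: eval_F_form eval_H_form)
qed

lemma flex_locus_lines: "(L, M) \<in> flex_locus \<Longrightarrow> L \<in> lines cubic_exponents \<and> M \<in> lines UNIV"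
  by (simp add: flex_locus_def PU_times_PV_eq)

lemma flex_locus_subset: "flex_locus \<subseteq> lines cubic_exponents \<times> lines UNIV"
  using flex_locus_lines by auto

lemma flex_locusI:
  assumes LM: "L \<in> lines cubic_exponents" "M \<in> lines UNIV" and c: "\<alpha> \<in> line_coords L" "x \<in> line_coords M"
    and F: "cubic (coeffs_of \<alpha>) x = 0" "hessian (coeffs_of \<alpha>) x = 0"
  shows "(L, M) \<in> flex_locus"
proof -
  have "eval_poly w F_form = 0 \<and> eval_poly w H_form = 0" if w: "w \<in> pair_coords (L, M)" for w
  proof -
    obtain \<beta> y where y: "\<beta> \<in> line_coords L" "y \<in> line_coords M" "w = case_sum \<beta> y"
      using w by (auto simp: pair_coords_iff)
    obtain b where b: "\<beta> = (\<lambda>e. b * \<alpha> e)" using line_coords_iff[OF LM(1) c(1)] y(1) by blast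
    obtain b' where b': "y = (\<lambda>i. b' * x i)" using line_coords_iff[OF LM(2) c(2)] y(2) by blast
    show ?thesis
      unfolding y(3) b b' eval_F_form eval_H_form cubic_biscale hessian_biscale using F by simp
  qed
  then show ?thesis
    using LM by (simp add: flex_locus_def PU_times_PV_eq)
qed

definition vec_of_coeffs :: "coeffs \<Rightarrow> (3 \<Rightarrow>\<^sub>0 nat) \<Rightarrow> complex" where
  "vec_of_coeffs a e = (if e \<in> cubic_exponents then a (lookup e 0) (lookup e 1) (lookup e 2) else 0)"

lemma coeffs_of_vec [simp]: "i + j + k = 3 \<Longrightarrow> coeffs_of (vec_of_coeffs a) i j k = a i j k"
  by (simp add: coeffs_of_def vec_of_coeffs_def)

lemma cubic_coeffs_cong:
  assumes "\<And>i j k. i + j + k = 3 \<Longrightarrow> a i j k = b i j k"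
  shows "cubic a v = cubic b v" "hessian a v = hessian b v" "d1 a v = d1 b v" "d2 a v = d2 b v"
    "d11 a v = d11 b v" "d12 a v = d12 b v" "d22 a v = d22 b v"
  unfolding cubic_def hessian_def d1_def d2_def d_defs by (simp_all add: assms)

lemma vec_of_coeffs_eqI:
  assumes "\<And>i j k. i + j + k = 3 \<Longrightarrow> a i j k = \<alpha> (expo i j k)" "\<And>e. e \<notin> cubic_exponents \<Longrightarrow> \<alpha> e = 0"
  shows "vec_of_coeffs a = \<alpha>"
proof
  fix e show "vec_of_coeffs a e = \<alpha> e"
  proof (cases "e \<in> cubic_exponents")
    case True
    then have "lookup e 0 + lookup e 1 + lookup e 2 = 3"
      by (simp add: cubic_exponents_def mono_degree_3)
    then show ?thesis
      using True assms(1)[of "lookup e 0" "lookup e 1" "lookup e 2"]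
      by (simp add: vec_of_coeffs_def expo_lookup)
  qed (simp add: vec_of_coeffs_def assms(2))
qed

text \<open>By \<open>vanishes_at_imp_cross\<close> the five linear forms of \<open>flex_coeffs\<close> may be replaced by arbitrary vectors
\<open>u 0, \<dots>, u 4\<close>; so the parameters of this family satisfy no equations, and segments between them make sense.\<close>

definition flex_family :: "(3 \<Rightarrow> complex) \<Rightarrow> (nat \<Rightarrow> 3 \<Rightarrow> complex) \<Rightarrow> coeffs \<Rightarrow> coeffs" where
  "flex_family x u q = flex_coeffs (cross x (u 0)) q (cross x (u 1)) (cross x (u 2)) (cross x (u 3)) (cross x (u 4))"

lemma flex_family_flex: "cubic (flex_family x u q) x = 0" "hessian (flex_family x u q) x = 0"
  unfolding flex_family_def by (rule flex_coeffs_flex; rule vanishes_at_cross)+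

lemma flex_family_surj:
  assumes "x \<noteq> (\<lambda>_. 0)" "cubic a x = 0" "hessian a x = 0"
  shows "\<exists>u q. \<forall>i j k. i + j + k = 3 \<longrightarrow> a i j k = flex_family x u q i j k"
proof -
  obtain l q n m n' m' where "vanishes_at l x" "vanishes_at n x" "vanishes_at m x"
    "vanishes_at n' x" "vanishes_at m' x"
    and a: "\<forall>i j k. i + j + k = 3 \<longrightarrow> a i j k = flex_coeffs l q n m n' m' i j k"
    using flex_form[OF assms] unfolding is_flex_form_def by blast
  then obtain u0 u1 u2 u3 u4 where u: "l = cross x u0" "n = cross x u1" "m = cross x u2"
    "n' = cross x u3" "m' = cross x u4"
    using vanishes_at_imp_cross[OF assms(1)] by metis
  define u where "u = (\<lambda>r::nat. [u0, u1, u2, u3, u4] ! r)"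
  have "flex_coeffs l q n m n' m' = flex_family x u q"
    by (simp add: flex_family_def u u_def)
  then show ?thesis using a by metis
qed

lemma poly_fun_if: "poly_fun g \<Longrightarrow> poly_fun h \<Longrightarrow> poly_fun (\<lambda>s. if b then g s else h s)"
  by (cases b) simp_all

lemma poly_fun_mult_lin:
  "(\<And>r. poly_fun (\<lambda>s. l s r)) \<Longrightarrow> (\<And>i j k. poly_fun (\<lambda>s. q s i j k)) \<Longrightarrow>
     poly_fun (\<lambda>s. mult_lin (l s) (q s) i j k)"
  unfolding mult_lin_def by (intro poly_fun_add poly_fun_if poly_fun_mult poly_fun_const)

lemma poly_fun_cross:
  "(\<And>r. poly_fun (\<lambda>s. x s r)) \<Longrightarrow> (\<And>r. poly_fun (\<lambda>s. u s r)) \<Longrightarrow> poly_fun (\<lambda>s. cross (x s) (u s) r)"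
  unfolding cross_def by (intro poly_fun_diff poly_fun_if poly_fun_mult)

lemma poly_fun_flex_family:
  assumes x: "\<And>r. poly_fun (\<lambda>s. x s r)" and u: "\<And>m r. poly_fun (\<lambda>s. u s m r)"
    and q: "\<And>i j k. poly_fun (\<lambda>s. q s i j k)"
  shows "poly_fun (\<lambda>s. flex_family (x s) (u s) (q s) i j k)"
  unfolding flex_family_def flex_coeffs_def
  by (intro poly_fun_add poly_fun_mult_lin poly_fun_cross x u q poly_fun_const)

text \<open>Two points of the flex variety come from two parameters of \<open>flex_family\<close>, and the curve is the image
of the segment between these. It can leave the variety only where the cubic or the point becomes
zero, hence the choice of \<open>\<delta>\<close> as a product of one coordinate of each.\<close>

lemma hyperconnected_flex_variety: "hyperconnected (zariski flex_variety)"
proof -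
  have "hyperconnected (subtopology (zariski (biproj.cspace cubic_exponents UNIV)) flex_locus)"
  proof (rule biproj.hyperconnected_by_curves)
    show "flex_locus \<subseteq> lines cubic_exponents \<times> lines UNIV"
      using flex_locus_lines by auto
  next
    fix a b assume a: "a \<in> flex_locus" and b: "b \<in> flex_locus"
    have param: "\<exists>\<alpha> x u q. case_sum \<alpha> x \<in> pair_coords c \<and> \<alpha> = vec_of_coeffs (flex_family x u q) \<and>
        \<alpha> \<noteq> (\<lambda>_. 0) \<and> x \<noteq> (\<lambda>_. 0)" if c: "c \<in> flex_locus" for c
    proof -
      obtain L M where LM: "c = (L, M)" by (cases c)
      note lines = flex_locus_lines[OF c[unfolded LM]]
      obtain \<alpha> x where \<alpha>: "\<alpha> \<in> line_coords L" and x: "x \<in> line_coords M"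
        using lines line_coords_nonempty by metis
      have nz: "\<alpha> \<noteq> (\<lambda>_. 0)" "x \<noteq> (\<lambda>_. 0)"
        using line_coords_nonzero lines \<alpha> x by blast+
      obtain u q where uq: "\<forall>i j k. i + j + k = 3 \<longrightarrow> coeffs_of \<alpha> i j k = flex_family x u q i j k"
        using flex_family_surj[OF nz(2)] flex_locusD[OF c[unfolded LM] \<alpha> x] by blast
      have "vec_of_coeffs (flex_family x u q) = \<alpha>"
        using uq line_coords_support[of L] lines \<alpha>
        by (intro vec_of_coeffs_eqI) (auto simp: coeffs_of_def)
      moreover have "case_sum \<alpha> x \<in> pair_coords c" using \<alpha> x LM by (auto simp: pair_coords_iff)
      ultimately show ?thesis using nz by metis
    qed
    obtain \<alpha> x u q where A: "case_sum \<alpha> x \<in> pair_coords a" "\<alpha> = vec_of_coeffs (flex_family x u q)"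
      "\<alpha> \<noteq> (\<lambda>_. 0)" "x \<noteq> (\<lambda>_. 0)" using param[OF a] by blast
    obtain \<beta> y w p where B: "case_sum \<beta> y \<in> pair_coords b" "\<beta> = vec_of_coeffs (flex_family y w p)"
      using param[OF b] by blast
    define X where "X s r = x r + s * (y r - x r)" for s r
    define U where "U s m r = u m r + s * (w m r - u m r)" for s m r
    define Q where "Q s i j k = q i j k + s * (p i j k - q i j k)" for s i j k
    define \<Gamma> where "\<Gamma> s = vec_of_coeffs (flex_family (X s) (U s) (Q s))" for s
    have X: "poly_fun (\<lambda>s. X s r)" for r
      unfolding X_def by (intro poly_fun_intros)
    have U: "poly_fun (\<lambda>s. U s m r)" for m r
      unfolding U_def by (intro poly_fun_intros)
    have Q: "poly_fun (\<lambda>s. Q s i j k)" for i j k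
      unfolding Q_def by (intro poly_fun_intros)
    have \<Gamma>: "poly_fun (\<lambda>s. \<Gamma> s e)" for e
      unfolding \<Gamma>_def vec_of_coeffs_def by (intro poly_fun_if poly_fun_flex_family X U Q poly_fun_const)
    have poly: "poly_fun (\<lambda>s. case_sum (\<Gamma> s) (X s) i)" for i
      by (cases i) (simp_all add: \<Gamma> X)
    have ends: "X 0 = x" "U 0 = u" "Q 0 = q" "X 1 = y" "U 1 = w" "Q 1 = p"
      by (simp_all add: X_def U_def Q_def fun_eq_iff)
    obtain e where e: "\<alpha> e \<noteq> 0" using A(3) by auto
    then have e': "e \<in> cubic_exponents" using A(2) by (auto simp: vec_of_coeffs_def split: if_splits)
    obtain r where r: "x r \<noteq> 0" using A(4) by auto
    have inside: "\<exists>c\<in>flex_locus. case_sum (\<Gamma> s) (X s) \<in> pair_coords c" if "\<Gamma> s e * X s r \<noteq> 0" for s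
    proof -
      have nz: "\<Gamma> s e \<noteq> 0" "X s r \<noteq> 0" using that by auto
      let ?L = "point cubic_exponents (\<Gamma> s)" and ?M = "point UNIV (X s)"
      have c: "\<Gamma> s \<in> line_coords ?L" "X s \<in> line_coords ?M"
        using nz e' by (auto intro!: point_coords simp: \<Gamma>_def vec_of_coeffs_def)
      have "(?L, ?M) \<in> flex_locus"
      proof (rule flex_locusI[OF _ _ c])
        show "?L \<in> lines cubic_exponents" "?M \<in> lines UNIV"
          using nz e' by (auto intro: point_in_lines)
        have "cubic (coeffs_of (\<Gamma> s)) (X s) = cubic (flex_family (X s) (U s) (Q s)) (X s)"
          "hessian (coeffs_of (\<Gamma> s)) (X s) = hessian (flex_family (X s) (U s) (Q s)) (X s)"
          by (intro cubic_coeffs_cong; simp add: \<Gamma>_def)+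
        then show "cubic (coeffs_of (\<Gamma> s)) (X s) = 0" "hessian (coeffs_of (\<Gamma> s)) (X s) = 0"
          by (simp_all only: flex_family_flex)
      qed
      then show ?thesis using c by (intro bexI) (auto simp: pair_coords_iff)
    qed
    have "\<Gamma> 0 = \<alpha>" "\<Gamma> 1 = \<beta>" using A(2) B(2) by (simp_all add: \<Gamma>_def ends)
    then show "\<exists>\<gamma> \<delta>. (\<forall>i. poly_fun (\<lambda>s. \<gamma> s i)) \<and> poly_fun \<delta> \<and> \<delta> 0 \<noteq> 0 \<and>
      \<gamma> 0 \<in> pair_coords a \<and> \<gamma> 1 \<in> pair_coords b \<and> (\<forall>s. \<delta> s \<noteq> 0 \<longrightarrow> (\<exists>c\<in>flex_locus. \<gamma> s \<in> pair_coords c))"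
      using poly inside A(1) B(1) e r
      by (intro exI[of _ "\<lambda>s. case_sum (\<Gamma> s) (X s)"] exI[of _ "\<lambda>s. \<Gamma> s e * X s r"])
         (auto simp: ends intro: poly_fun_mult \<Gamma> X)
  qed
  then show ?thesis
    by (simp add: flex_variety_def PU_times_PV_eq)
qed


section \<open>A birational parametrization\<close>

text \<open>The normal form of \<open>local_form\<close> with \<open>t = l\<^sub>1 = 1\<close> at the point \<open>(1, z\<^sub>1, z\<^sub>2)\<close>, with
\<open>l\<^sub>2 = z\<^sub>3\<close>, \<open>M\<^sub>1 = z\<^sub>4\<close>, \<open>M\<^sub>2 = z\<^sub>5\<close> and the binary cubic given by \<open>z\<^sub>6, \<dots>, z\<^sub>9\<close>,
homogenized with \<open>z\<^sub>0\<close>. The coefficients become forms of degree 4 in \<open>z\<close>.\<close>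

definition chart_coeffs :: "(nat \<Rightarrow> complex) \<Rightarrow> coeffs" where
  "chart_coeffs z = (let
     x = (\<lambda>r::3. if r = 0 then 1 else 0);
     n = (\<lambda>r::3. if r = 0 then - z 1 else if r = 1 then z 0 else 0);
     n' = (\<lambda>r::3. if r = 0 then - z 2 else if r = 2 then z 0 else 0)
   in flex_coeffs (\<lambda>r. z 0 * n r + z 3 * n' r)
     (mult_lin x (mult_lin (\<lambda>r. z 0 * z 0 * x r + z 4 * n r + z 5 * n' r) unit_coeffs))
     n (\<lambda>r. z 6 * n r + z 7 * n' r) n' (\<lambda>r. z 8 * n r + z 9 * n' r))"

definition chart_point :: "(nat \<Rightarrow> complex) \<Rightarrow> 3 \<Rightarrow> complex" where
  "chart_point z r = (if r = 0 then z 0 else if r = 1 then z 1 else z 2)"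

lemma chart_point_simps [simp]:
  "chart_point z 0 = z 0" "chart_point z 1 = z 1" "chart_point z 2 = z 2"
  by (simp_all add: chart_point_def)

lemma (in graded_polys) is_form_if: "is_form d g \<Longrightarrow> is_form d h \<Longrightarrow> is_form d (\<lambda>v. if b then g v else h v)"
  by (cases b) simp_all

lemma (in graded_polys) is_form_mult_lin:
  assumes "\<And>r. is_form d (\<lambda>v. l v r)" "\<And>i j k. is_form e (\<lambda>v. q v i j k)" "d' = d + e"
  shows "is_form d' (\<lambda>v. mult_lin (l v) (q v) i j k)"
  unfolding mult_lin_def
  by (intro is_form_add is_form_if is_form_0; rule is_form_mult[OF assms])

lemma is_form_chart_coeffs: "homog.is_form 4 (\<lambda>z. chart_coeffs z i j k)"
proof -
  define x :: "3 \<Rightarrow> complex" where "x r = (if r = 0 then 1 else 0)" for r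
  define n :: "(nat \<Rightarrow> complex) \<Rightarrow> 3 \<Rightarrow> complex" where
    "n z r = (if r = 0 then - z 1 else if r = 1 then z 0 else 0)" for z r
  define n' :: "(nat \<Rightarrow> complex) \<Rightarrow> 3 \<Rightarrow> complex" where
    "n' z r = (if r = 0 then - z 2 else if r = 2 then z 0 else 0)" for z r
  have z: "homog.is_form 1 (\<lambda>z. z i)" for i :: nat
    by (rule homog.is_form_var) simp
  have n: "homog.is_form 1 (\<lambda>z. n z r)" "homog.is_form 1 (\<lambda>z. n' z r)" for r
    unfolding n_def n'_def by (intro homog.is_form_if homog.is_form_uminus z homog.is_form_0)+
  have zn: "homog.is_form 2 (\<lambda>z. z i * n z r)" "homog.is_form 2 (\<lambda>z. z i * n' z r)" for i r
    by (rule homog.is_form_mult[OF z n(1)] homog.is_form_mult[OF z n(2)]; simp)+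
  have lin: "homog.is_form 2 (\<lambda>z. z i * n z r + z j * n' z r)" for i j r
    by (intro homog.is_form_add zn)
  have x: "homog.is_form 0 (\<lambda>z :: nat \<Rightarrow> complex. x r)" for r
    by (rule homog.is_form_const)
  have unit: "homog.is_form 0 (\<lambda>z :: nat \<Rightarrow> complex. unit_coeffs i j k)" for i j k
    by (rule homog.is_form_const)
  have "homog.is_form 2 (\<lambda>z :: nat \<Rightarrow> complex. z 0 * z 0 * x r)" for r
    by (rule homog.is_form_mult[of 2 _ 0], rule homog.is_form_mult[of 1 _ 1], rule z, rule z, simp, rule x, simp)
  then have lin': "homog.is_form 2 (\<lambda>z. z 0 * z 0 * x r + z 4 * n z r + z 5 * n' z r)" for r
    by (intro homog.is_form_add zn)
  have nn: "homog.is_form 2 (\<lambda>z. mult_lin (n z) (mult_lin (n z) unit_coeffs) i j k)"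
    "homog.is_form 2 (\<lambda>z. mult_lin (n' z) (mult_lin (n' z) unit_coeffs) i j k)" for i j k
    by (rule homog.is_form_mult_lin[OF n(1) homog.is_form_mult_lin[OF n(1) unit refl]]
        homog.is_form_mult_lin[OF n(2) homog.is_form_mult_lin[OF n(2) unit refl]]; simp)+
  have C: "chart_coeffs z i j k = mult_lin (\<lambda>r. z 0 * n z r + z 3 * n' z r)
     (mult_lin x (mult_lin (\<lambda>r. z 0 * z 0 * x r + z 4 * n z r + z 5 * n' z r) unit_coeffs)) i j k
     + mult_lin (\<lambda>r. z 6 * n z r + z 7 * n' z r) (mult_lin (n z) (mult_lin (n z) unit_coeffs)) i j k
     + mult_lin (\<lambda>r. z 8 * n z r + z 9 * n' z r) (mult_lin (n' z) (mult_lin (n' z) unit_coeffs)) i j k"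
    for z
    unfolding chart_coeffs_def flex_coeffs_def Let_def x_def[abs_def] n_def[abs_def] n'_def[abs_def] ..
  show ?thesis
    unfolding C
  proof (intro homog.is_form_add)
    show "homog.is_form 4 (\<lambda>z. mult_lin (\<lambda>r. z 0 * n z r + z 3 * n' z r)
     (mult_lin x (mult_lin (\<lambda>r. z 0 * z 0 * x r + z 4 * n z r + z 5 * n' z r) unit_coeffs)) i j k)"
      by (rule homog.is_form_mult_lin[OF lin homog.is_form_mult_lin[OF x homog.is_form_mult_lin[OF lin' unit refl] refl]]) simp
    show "homog.is_form 4 (\<lambda>z. mult_lin (\<lambda>r. z 6 * n z r + z 7 * n' z r)
        (mult_lin (n z) (mult_lin (n z) unit_coeffs)) i j k)"
      by (rule homog.is_form_mult_lin[OF lin nn(1)]) simp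
    show "homog.is_form 4 (\<lambda>z. mult_lin (\<lambda>r. z 8 * n z r + z 9 * n' z r)
        (mult_lin (n' z) (mult_lin (n' z) unit_coeffs)) i j k)"
      by (rule homog.is_form_mult_lin[OF lin nn(2)]) simp
  qed
qed

text \<open>The parameters recovered from the cubic and the point, through derivatives of the cubic. If
  \<open>x\<^sub>0 = A = 1\<close>, then these are \<open>(1, x\<^sub>1, x\<^sub>2, B, Q, R - B Q)\<close> followed by the four coefficients
  without \<open>x\<^sub>0\<close>; the powers of \<open>x\<^sub>0\<close> and \<open>A\<close> clear the denominators and make all of them forms
  of bidegree \<open>(2, 5)\<close>. The component with index 5 is the second coefficient of \<open>M\<close>, because
  \<open>R = M\<^sub>2 + B M\<^sub>1\<close> and \<open>M\<^sub>1 = Q\<close>.\<close>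

definition chart_params :: "nat \<Rightarrow> ((3 \<Rightarrow>\<^sub>0 nat) + 3 \<Rightarrow> complex) \<Rightarrow> complex" where
  "chart_params j w = (let a = coeffs_of (\<lambda>e. w (Inl e)); x = (\<lambda>i. w (Inr i));
       A = d1 a x; B = d2 a x; Q = d11 a x / 2; R = d12 a x
     in if j < 10 then
       [x 0 * (A * A), x 1 * (A * A), x 2 * (A * A), x 0 * (A * B), x 0 * x 0 * (Q * A), x 0 * x 0 * (R * A - B * Q),
        x 0 * x 0 * x 0 * (a 0 3 0 * A), x 0 * x 0 * x 0 * (a 0 2 1 * A),
        x 0 * x 0 * x 0 * (a 0 1 2 * A), x 0 * x 0 * x 0 * (a 0 0 3 * A)] ! j
     else 0)"

lemma is_form_var_x: "bihomog.is_form (0, 1) (\<lambda>w. w (Inr i))"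
  by (rule bihomog.is_form_var) simp

lemma is_form_var_coeffs: "bihomog.is_form (1, 0) (\<lambda>w. coeffs_of (\<lambda>e. w (Inl e)) i j k)"
  unfolding coeffs_of_def by (rule bihomog.is_form_var) simp

lemma is_form_d1: "bihomog.is_form (1, 2) (\<lambda>w. d1 (coeffs_of (\<lambda>e. w (Inl e))) (\<lambda>i. w (Inr i)))"
  and is_form_d2: "bihomog.is_form (1, 2) (\<lambda>w. d2 (coeffs_of (\<lambda>e. w (Inl e))) (\<lambda>i. w (Inr i)))"
  and is_form_d11: "bihomog.is_form (1, 1) (\<lambda>w. d11 (coeffs_of (\<lambda>e. w (Inl e))) (\<lambda>i. w (Inr i)))"
  and is_form_d12: "bihomog.is_form (1, 1) (\<lambda>w. d12 (coeffs_of (\<lambda>e. w (Inl e))) (\<lambda>i. w (Inr i)))"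
  unfolding d1_def d2_def d11_def d12_def power2_eq_square
  by (intro bihomog.is_form_add;
      (rule bihomog.is_form_mult bihomog.is_form_const is_form_var_coeffs is_form_var_x refl | simp)+)+

lemma is_form_chart_params: "bihomog.is_form (2, 5) (chart_params j)"
proof -
  define X where "X r w = w (Inr r)" for r and w :: "(3 \<Rightarrow>\<^sub>0 nat) + 3 \<Rightarrow> complex"
  define C where "C j k w = coeffs_of (\<lambda>e. w (Inl e)) 0 j k" for j k and w :: "(3 \<Rightarrow>\<^sub>0 nat) + 3 \<Rightarrow> complex"
  define A where "A w = d1 (coeffs_of (\<lambda>e. w (Inl e))) (\<lambda>i. w (Inr i))" for w
  define B where "B w = d2 (coeffs_of (\<lambda>e. w (Inl e))) (\<lambda>i. w (Inr i))" for w
  define Q where "Q w = d11 (coeffs_of (\<lambda>e. w (Inl e))) (\<lambda>i. w (Inr i)) / 2" for w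
  define R where "R w = d12 (coeffs_of (\<lambda>e. w (Inl e))) (\<lambda>i. w (Inr i))" for w
  have X: "bihomog.is_form (0, 1) (X r)" for r
    unfolding X_def[abs_def] by (rule is_form_var_x)
  have C: "bihomog.is_form (1, 0) (C j k)" for j k
    unfolding C_def[abs_def] by (rule is_form_var_coeffs)
  have A: "bihomog.is_form (1, 2) A" and B: "bihomog.is_form (1, 2) B" and R: "bihomog.is_form (1, 1) R"
    unfolding A_def[abs_def] B_def[abs_def] R_def[abs_def] by (rule is_form_d1 is_form_d2 is_form_d12)+
  have Q: "bihomog.is_form (1, 1) Q"
    using bihomog.is_form_cmult[OF is_form_d11, of "1 / 2"] by (simp add: Q_def[abs_def])
  have XX: "bihomog.is_form (0, 2) (\<lambda>w. X 0 w * X 0 w)"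
    by (rule bihomog.is_form_mult[OF X X]) simp
  have XXX: "bihomog.is_form (0, 3) (\<lambda>w. X 0 w * X 0 w * X 0 w)"
    by (rule bihomog.is_form_mult[OF XX X]) simp
  have AA: "bihomog.is_form (2, 4) (\<lambda>w. A w * A w)" and AB: "bihomog.is_form (2, 4) (\<lambda>w. A w * B w)"
    by (rule bihomog.is_form_mult[OF A A] bihomog.is_form_mult[OF A B]; simp)+
  have QA: "bihomog.is_form (2, 3) (\<lambda>w. Q w * A w)"
    by (rule bihomog.is_form_mult[OF Q A]) simp
  have RABQ: "bihomog.is_form (2, 3) (\<lambda>w. R w * A w - B w * Q w)"
    by (rule bihomog.is_form_diff; rule bihomog.is_form_mult[OF R A] bihomog.is_form_mult[OF B Q]; simp)
  have CA: "bihomog.is_form (2, 2) (\<lambda>w. C j k w * A w)" for j k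
    by (rule bihomog.is_form_mult[OF C A]) simp
  define hs where "hs = [\<lambda>w. X 0 w * (A w * A w), \<lambda>w. X 1 w * (A w * A w), \<lambda>w. X 2 w * (A w * A w),
    \<lambda>w. X 0 w * (A w * B w), \<lambda>w. X 0 w * X 0 w * (Q w * A w), \<lambda>w. X 0 w * X 0 w * (R w * A w - B w * Q w),
    \<lambda>w. X 0 w * X 0 w * X 0 w * (C 3 0 w * A w), \<lambda>w. X 0 w * X 0 w * X 0 w * (C 2 1 w * A w),
    \<lambda>w. X 0 w * X 0 w * X 0 w * (C 1 2 w * A w), \<lambda>w. X 0 w * X 0 w * X 0 w * (C 0 3 w * A w)]"
  have "bihomog.is_form (2, 5) (\<lambda>w. X r w * (A w * A w))" "bihomog.is_form (2, 5) (\<lambda>w. X r w * (A w * B w))"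
    "bihomog.is_form (2, 5) (\<lambda>w. X 0 w * X 0 w * (Q w * A w))"
    "bihomog.is_form (2, 5) (\<lambda>w. X 0 w * X 0 w * (R w * A w - B w * Q w))"
    "bihomog.is_form (2, 5) (\<lambda>w. X 0 w * X 0 w * X 0 w * (C j k w * A w))" for r j k
    by (rule bihomog.is_form_mult[OF X AA] bihomog.is_form_mult[OF X AB] bihomog.is_form_mult[OF XX QA]
          bihomog.is_form_mult[OF XX RABQ] bihomog.is_form_mult[OF XXX CA]; simp)+
  then have forms: "bihomog.is_form (2, 5) h" if "h \<in> set hs" for h
    using that by (auto simp: hs_def)
  have len: "length hs = 10" by (simp add: hs_def)
  have "bihomog.is_form (2, 5) (hs ! j)" if "j < 10"
    using that by (intro forms nth_mem) (simp add: len)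
  moreover have "chart_params j = (if j < 10 then hs ! j else (\<lambda>w. 0))"
  proof
    fix w
    have "chart_params j w = (if j < 10 then map (\<lambda>h. h w) hs ! j else 0)"
      unfolding hs_def chart_params_def Let_def list.map X_def A_def B_def Q_def R_def C_def
      by (rule refl)
    then show "chart_params j w = (if j < 10 then hs ! j else (\<lambda>w. 0)) w"
      by (simp add: len)
  qed
  ultimately show ?thesis by (simp add: bihomog.is_form_0)
qed


lemma chart_params_normalized:
  assumes "x 0 = 1" "d1 (coeffs_of \<alpha>) x = 1"
  defines "z \<equiv> \<lambda>j. chart_params j (case_sum \<alpha> x)"
  shows "z 0 = 1" "z 1 = x 1" "z 2 = x 2" "z 3 = d2 (coeffs_of \<alpha>) x" "z 4 = d11 (coeffs_of \<alpha>) x / 2"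
    "z 5 = d12 (coeffs_of \<alpha>) x - d2 (coeffs_of \<alpha>) x * (d11 (coeffs_of \<alpha>) x / 2)"
    "z 6 = coeffs_of \<alpha> 0 3 0" "z 7 = coeffs_of \<alpha> 0 2 1" "z 8 = coeffs_of \<alpha> 0 1 2" "z 9 = coeffs_of \<alpha> 0 0 3"
    "\<And>j. j \<ge> 10 \<Longrightarrow> z j = 0"
  using assms(1,2) by (simp_all add: z_def chart_params_def Let_def)

text \<open>The condition on the Hessian enters by determining \<open>d22\<close>, the only second derivative occurring in
\<open>local_form\<close> that is not among the parameters.\<close>

lemma chart_coeffs_chart_params:
  assumes x: "x 0 = 1" "d1 (coeffs_of \<alpha>) x = 1"
    and F: "cubic (coeffs_of \<alpha>) x = 0" "hessian (coeffs_of \<alpha>) x = 0"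
    and ijk: "i + j + k = 3"
  shows "chart_coeffs (\<lambda>j. chart_params j (case_sum \<alpha> x)) i j k = coeffs_of \<alpha> i j k"
proof -
  define a where "a = coeffs_of \<alpha>"
  define z where "z = (\<lambda>j. chart_params j (case_sum \<alpha> x))"
  have z: "z 0 = 1" "z 1 = x 1" "z 2 = x 2" "z 3 = d2 a x" "z 4 = d11 a x / 2"
    "z 5 = d12 a x - d2 a x * (d11 a x / 2)"
    "z 6 = a 0 3 0" "z 7 = a 0 2 1" "z 8 = a 0 1 2" "z 9 = a 0 0 3"
    unfolding z_def a_def by (rule chart_params_normalized[OF x])+
  have "1 ^ 2 * d22 a x - 2 * 1 * d2 a x * d12 a x + d2 a x ^ 2 * d11 a x = 0"
    using flex_tangent_relation[OF F] x(2) unfolding a_def by simp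
  then have d22: "d22 a x = 2 * z 3 * z 5"
    unfolding z by (simp add: algebra_simps power2_eq_square)
  have "a i j k = chart_coeffs z i j k"
    unfolding chart_coeffs_def Let_def
  proof -
    let ?x = "\<lambda>r::3. if r = 0 then 1 else 0 :: complex"
    let ?n = "\<lambda>r::3. if r = 0 then - z 1 else if r = 1 then z 0 else 0"
    let ?n' = "\<lambda>r::3. if r = 0 then - z 2 else if r = 2 then z 0 else 0"
    have "a i j k = flex_coeffs (\<lambda>r. 1 * ?n r + z 3 * ?n' r)
     (mult_lin ?x (mult_lin (\<lambda>r. 1 * ?x r + z 4 * ?n r + z 5 * ?n' r) unit_coeffs))
     ?n (\<lambda>r. a 0 3 0 * ?n r + a 0 2 1 * ?n' r) ?n' (\<lambda>r. a 0 1 2 * ?n r + a 0 0 3 * ?n' r) i j k"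
    proof (rule local_form[of x a 1 1 "z 3" "z 4" "z 5"])
      show "x 0 = 1" "cubic a x = 0" using x F by (simp_all add: a_def)
      show "d1 a x = 1 * 1" "d2 a x = 1 * z 3" using x z by (simp_all add: a_def)
      show "d11 a x = 2 * 1 * z 4" "d12 a x = 1 * z 5 + z 3 * z 4" "d22 a x = 2 * z 3 * z 5"
        unfolding d22 unfolding z by simp_all
    qed (simp_all add: z z(2)[unfolded One_nat_def] ijk)
    then show "a i j k = flex_coeffs (\<lambda>r. z 0 * ?n r + z 3 * ?n' r)
     (mult_lin ?x (mult_lin (\<lambda>r. z 0 * z 0 * ?x r + z 4 * ?n r + z 5 * ?n' r) unit_coeffs))
     ?n (\<lambda>r. z 6 * ?n r + z 7 * ?n' r) ?n' (\<lambda>r. z 8 * ?n r + z 9 * ?n' r) i j k"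
      unfolding z(1) z(7-10) by simp
  qed
  then show ?thesis by (simp add: z_def a_def)
qed

lemma chart_coeffs_flex:
  "cubic (chart_coeffs z) (chart_point z) = 0" "hessian (chart_coeffs z) (chart_point z) = 0"
  unfolding chart_coeffs_def Let_def
  by (rule flex_coeffs_flex; simp add: vanishes_at_def algebra_simps)+

lemma chart_coeffs_derivs:
  assumes "z 0 = 1"
  shows "d1 (chart_coeffs z) (chart_point z) = 1" "d2 (chart_coeffs z) (chart_point z) = z 3"
    "d11 (chart_coeffs z) (chart_point z) = 2 * z 4" "d12 (chart_coeffs z) (chart_point z) = z 5 + z 3 * z 4"
    "chart_coeffs z 0 3 0 = z 6" "chart_coeffs z 0 2 1 = z 7" "chart_coeffs z 0 1 2 = z 8" "chart_coeffs z 0 0 3 = z 9"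
proof -
  define a where "a = chart_coeffs z"
  note defs = a_def chart_coeffs_def Let_def flex_coeffs_def mult_lin_def unit_coeffs_def
  have top: "a 0 3 0 = z 6" "a 0 2 1 = z 7" "a 0 1 2 = z 8" "a 0 0 3 = z 9"
    by (simp_all add: defs assms)
  have a120: "a 1 2 0 = z 4 - 3 * z 6 * z 1 - z 7 * z 2"
    by (simp add: defs assms; algebra)
  have a111: "a 1 1 1 = z 5 + z 3 * z 4 - 2 * z 7 * z 1 - 2 * z 8 * z 2"
    by (simp add: defs assms; algebra)
  have a102: "a 1 0 2 = z 3 * z 5 - z 8 * z 1 - 3 * z 9 * z 2"
    by (simp add: defs assms; algebra)
  have a210: "a 2 1 0 = 1 - (2 * a 1 2 0 * z 1 + a 1 1 1 * z 2 + 3 * z 6 * z 1^2 + 2 * z 7 * z 1 * z 2 + z 8 * z 2^2)"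
    unfolding a120 a111 by (simp add: defs assms; algebra)
  have a201: "a 2 0 1 = z 3 - (a 1 1 1 * z 1 + 2 * a 1 0 2 * z 2 + z 7 * z 1^2 + 2 * z 8 * z 1 * z 2 + 3 * z 9 * z 2^2)"
    unfolding a102 a111 by (simp add: defs assms; algebra)
  show "chart_coeffs z 0 3 0 = z 6" "chart_coeffs z 0 2 1 = z 7" "chart_coeffs z 0 1 2 = z 8" "chart_coeffs z 0 0 3 = z 9"
    using top by (simp_all only: a_def)
  show "d1 (chart_coeffs z) (chart_point z) = 1" "d2 (chart_coeffs z) (chart_point z) = z 3"
    "d11 (chart_coeffs z) (chart_point z) = 2 * z 4" "d12 (chart_coeffs z) (chart_point z) = z 5 + z 3 * z 4"
    unfolding d1_def d2_def d11_def d12_def chart_point_simps assms a_def[symmetric] a210 a201 a120 a111 top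
    by (simp_all add: algebra_simps power2_eq_square)
qed

lemma (in coordinates) is_form_scale:
  assumes "a \<in> A" "v \<in> coords a" "w \<in> coords a"
  shows "\<exists>c. c \<noteq> 0 \<and> (\<forall>h. is_form d h \<longrightarrow> h w = c * h v)"
  using coords_scale[OF assms] by (fastforce simp: is_form_def)

text \<open>The two rational maps. The choice of a coordinate vector does not matter (\<open>to_chart_eq\<close>,
\<open>from_chart_eq\<close>), as the coordinates of each resulting line are forms of one common degree.\<close>

definition to_chart ::
  "((3 \<Rightarrow>\<^sub>0 nat) \<Rightarrow>\<^sub>0 complex) set \<times> (3 \<Rightarrow>\<^sub>0 complex) set \<Rightarrow> (nat \<Rightarrow>\<^sub>0 complex) set" where
  "to_chart a = point {..9} (\<lambda>j. chart_params j (SOME w. w \<in> pair_coords a))"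

definition from_chart ::
  "(nat \<Rightarrow>\<^sub>0 complex) set \<Rightarrow> ((3 \<Rightarrow>\<^sub>0 nat) \<Rightarrow>\<^sub>0 complex) set \<times> (3 \<Rightarrow>\<^sub>0 complex) set" where
  "from_chart L = (let z = SOME z. z \<in> line_coords L in
     (point cubic_exponents (vec_of_coeffs (chart_coeffs z)), point UNIV (chart_point z)))"

lemma to_chart_eq:
  assumes "a \<in> flex_locus" "w \<in> pair_coords a"
  shows "to_chart a = point {..9} (\<lambda>j. chart_params j w)"
proof -
  have a: "a \<in> lines cubic_exponents \<times> lines UNIV"
    using assms(1) flex_locus_lines by (cases a) auto
  let ?v = "SOME w. w \<in> pair_coords a"
  have "?v \<in> pair_coords a" by (rule someI[of "\<lambda>w. w \<in> pair_coords a", OF assms(2)])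
  then obtain c where c: "c \<noteq> 0" "\<And>h. bihomog.is_form (2, 5) h \<Longrightarrow> h ?v = c * h w"
    using biproj.is_form_scale[OF a assms(2)] by blast
  show ?thesis
    unfolding to_chart_def c(2)[OF is_form_chart_params] by (rule point_scale) (use c(1) in auto)
qed

lemma from_chart_eq:
  assumes "L \<in> lines {..9}" "z \<in> line_coords L"
  shows "from_chart L = (point cubic_exponents (vec_of_coeffs (chart_coeffs z)), point UNIV (chart_point z))"
proof -
  define y where "y = (SOME z. z \<in> line_coords L)"
  have y: "y \<in> line_coords L" unfolding y_def by (rule someI[of "\<lambda>z. z \<in> line_coords L", OF assms(2)])
  obtain c where c: "c \<noteq> 0" "\<And>h. homog.is_form 4 h \<Longrightarrow> h y = c * h z"
    using proj.is_form_scale[OF assms y] by blast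
  obtain b where b: "b \<noteq> 0" "y = (\<lambda>i. b * z i)"
    using line_coords_iff[OF assms] y by blast
  have "vec_of_coeffs (chart_coeffs y) = (\<lambda>e. c * vec_of_coeffs (chart_coeffs z) e)"
    using c(2)[OF is_form_chart_coeffs] by (auto simp: vec_of_coeffs_def fun_eq_iff)
  moreover have "chart_point y = (\<lambda>r. b * chart_point z r)"
    by (auto simp: b(2) chart_point_def fun_eq_iff)
  ultimately show ?thesis
    using b(1) c(1) by (simp add: from_chart_def y_def[symmetric] point_scale)
qed

definition chart_domain :: "(((3 \<Rightarrow>\<^sub>0 nat) \<Rightarrow>\<^sub>0 complex) set \<times> (3 \<Rightarrow>\<^sub>0 complex) set) set" where
  "chart_domain = {a \<in> flex_locus. \<forall>w\<in>pair_coords a.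
     w (Inr 0) \<noteq> 0 \<and> d1 (coeffs_of (\<lambda>e. w (Inl e))) (\<lambda>i. w (Inr i)) \<noteq> 0}"

definition chart_range :: "(nat \<Rightarrow>\<^sub>0 complex) set set" where
  "chart_range = {L \<in> lines {..9}. \<forall>z\<in>line_coords L. z 0 \<noteq> 0}"

lemma d1_biscale: "d1 (coeffs_of (\<lambda>e. c * \<alpha> e)) (\<lambda>i. c' * x i) = c * c' ^ 2 * d1 (coeffs_of \<alpha>) x"
  unfolding d1_def coeffs_of_def by algebra

text \<open>Scaling the point makes \<open>x\<^sub>0\<close> equal to 1, and scaling the cubic then does the same for the derivative;
in this normalization the two rational maps have no denominators and are compared directly.\<close>

lemma chart_domain_normalized:
  assumes "(L, M) \<in> chart_domain"
  shows "\<exists>\<alpha>\<in>line_coords L. \<exists>x\<in>line_coords M. x 0 = 1 \<and> d1 (coeffs_of \<alpha>) x = 1"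
proof -
  have LM: "(L, M) \<in> flex_locus" using assms by (simp add: chart_domain_def)
  note lines = flex_locus_lines[OF LM]
  obtain \<alpha> x where c: "\<alpha> \<in> line_coords L" "x \<in> line_coords M"
    using lines line_coords_nonempty by metis
  then have "case_sum \<alpha> x \<in> pair_coords (L, M)" by (auto simp: pair_coords_iff)
  then have nz: "x 0 \<noteq> 0" "d1 (coeffs_of \<alpha>) x \<noteq> 0"
    using assms unfolding chart_domain_def by fastforce+
  let ?c' = "inverse (x 0)" and ?c = "x 0 ^ 2 / d1 (coeffs_of \<alpha>) x"
  have "d1 (coeffs_of (\<lambda>e. ?c * \<alpha> e)) (\<lambda>i. ?c' * x i) = 1"
    unfolding d1_biscale using nz by (simp add: field_simps)
  moreover have "(\<lambda>e. ?c * \<alpha> e) \<in> line_coords L" "(\<lambda>i. ?c' * x i) \<in> line_coords M"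
    by (rule line_coords_scale[OF conjunct1[OF lines] c(1)] line_coords_scale[OF conjunct2[OF lines] c(2)];
        use nz in simp)+
  ultimately show ?thesis using nz(1) by (intro bexI) auto
qed

lemma chart_domainI:
  assumes "(L, M) \<in> flex_locus" "\<alpha> \<in> line_coords L" "x \<in> line_coords M"
    and "x 0 \<noteq> 0" "d1 (coeffs_of \<alpha>) x \<noteq> 0"
  shows "(L, M) \<in> chart_domain"
proof -
  note lines = flex_locus_lines[OF assms(1)]
  have "w (Inr 0) \<noteq> 0 \<and> d1 (coeffs_of (\<lambda>e. w (Inl e))) (\<lambda>i. w (Inr i)) \<noteq> 0"
    if w: "w \<in> pair_coords (L, M)" for w
  proof -
    obtain \<beta> y where y: "\<beta> \<in> line_coords L" "y \<in> line_coords M" "w = case_sum \<beta> y"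
      using w by (auto simp: pair_coords_iff)
    obtain b where b: "b \<noteq> 0" "\<beta> = (\<lambda>e. b * \<alpha> e)" using line_coords_iff lines assms(2) y(1) by blast
    obtain b' where b': "b' \<noteq> 0" "y = (\<lambda>i. b' * x i)" using line_coords_iff lines assms(3) y(2) by blast
    show ?thesis
      unfolding y(3) b(2) b'(2) using assms(4,5) b(1) b'(1) by (simp add: d1_biscale)
  qed
  then show ?thesis using assms(1) by (simp add: chart_domain_def)
qed

lemma chart_range_normalized:
  assumes "L \<in> chart_range"
  shows "\<exists>z\<in>line_coords L. z 0 = 1"
proof -
  have L: "L \<in> lines {..9}" using assms by (simp add: chart_range_def)
  obtain z where z: "z \<in> line_coords L" using L line_coords_nonempty by blast
  then have "z 0 \<noteq> 0" using assms by (simp add: chart_range_def)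
  then show ?thesis
    using line_coords_scale[OF L z, of "inverse (z 0)"] by (intro bexI) auto
qed

lemma to_chart_in_lines:
  assumes "a \<in> chart_domain" "w \<in> pair_coords a"
  shows "to_chart a \<in> lines {..9}" "(\<lambda>j. chart_params j w) \<in> line_coords (to_chart a)"
proof -
  have a: "a \<in> flex_locus" using assms by (simp add: chart_domain_def)
  have "chart_params 0 w \<noteq> 0"
    using assms by (simp add: chart_domain_def chart_params_def Let_def)
  moreover have "chart_params j w = 0" if "j \<notin> {..9}" for j
    using that by (simp add: chart_params_def Let_def)
  ultimately show "to_chart a \<in> lines {..9}" "(\<lambda>j. chart_params j w) \<in> line_coords (to_chart a)"
    unfolding to_chart_eq[OF a assms(2)]
    by (auto intro!: point_in_lines[of _ 0] point_coords[of _ 0])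
qed

lemma to_chart_in_range:
  assumes "a \<in> chart_domain"
  shows "to_chart a \<in> chart_range"
proof -
  obtain L M where LM: "a = (L, M)" by (cases a)
  obtain \<alpha> x where \<alpha>: "\<alpha> \<in> line_coords L" "x \<in> line_coords M" "x 0 = 1" "d1 (coeffs_of \<alpha>) x = 1"
    using chart_domain_normalized assms LM by blast
  have w: "case_sum \<alpha> x \<in> pair_coords a" using \<alpha> LM by (auto simp: pair_coords_iff)
  have "z 0 \<noteq> 0" if "z \<in> line_coords (to_chart a)" for z
    using line_coords_iff[OF to_chart_in_lines[OF assms w]] that chart_params_normalized(1)[OF \<alpha>(3,4)] by auto
  then show ?thesis
    using to_chart_in_lines[OF assms w] by (simp add: chart_range_def)
qed

lemma from_to_chart:
  assumes "a \<in> chart_domain"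
  shows "from_chart (to_chart a) = a"
proof -
  obtain L M where LM: "a = (L, M)" by (cases a)
  have fl: "(L, M) \<in> flex_locus" using assms LM by (simp add: chart_domain_def)
  note lines = flex_locus_lines[OF fl]
  obtain \<alpha> x where \<alpha>: "\<alpha> \<in> line_coords L" "x \<in> line_coords M" and n: "x 0 = 1" "d1 (coeffs_of \<alpha>) x = 1"
    using chart_domain_normalized assms LM by blast
  have w: "case_sum \<alpha> x \<in> pair_coords a" using \<alpha> LM by (auto simp: pair_coords_iff)
  let ?z = "\<lambda>j. chart_params j (case_sum \<alpha> x)"
  have "vec_of_coeffs (chart_coeffs ?z) = \<alpha>"
    using chart_coeffs_chart_params[OF n flex_locusD[OF fl \<alpha>]] line_coords_support[of L _ \<alpha>] lines \<alpha>
    by (intro vec_of_coeffs_eqI) (auto simp: coeffs_of_def)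
  moreover have "chart_point ?z = x"
  proof
    fix r show "chart_point ?z r = x r"
      using cases_3[of r] chart_params_normalized(1-3)[OF n] n by auto
  qed
  ultimately show ?thesis
    unfolding from_chart_eq[OF to_chart_in_lines[OF assms w]]
    using line_eq_point[of cubic_exponents L \<alpha>] line_eq_point[of UNIV M x] lines \<alpha> LM by simp
qed

lemma from_chart_coords:
  assumes "L \<in> lines {..9}" "z \<in> line_coords L" "z 0 \<noteq> 0"
  shows "vec_of_coeffs (chart_coeffs z) \<in> line_coords (fst (from_chart L))" (is ?A)
    and "chart_point z \<in> line_coords (snd (from_chart L))" (is ?B)
    and "from_chart L \<in> chart_domain" (is ?C)
proof -
  define y where "y = (\<lambda>i. inverse (z 0) * z i)"
  have y: "y \<in> line_coords L" "y 0 = 1"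
    using line_coords_scale[OF assms(1,2), of "inverse (z 0)"] assms(3) by (auto simp: y_def)
  let ?a = "vec_of_coeffs (chart_coeffs y)"
  have cong: "cubic (coeffs_of ?a) v = cubic (chart_coeffs y) v"
    "hessian (coeffs_of ?a) v = hessian (chart_coeffs y) v" "d1 (coeffs_of ?a) v = d1 (chart_coeffs y) v" for v
    by (rule cubic_coeffs_cong; simp)+
  have d1: "d1 (coeffs_of ?a) (chart_point y) = 1"
    unfolding cong by (rule chart_coeffs_derivs) fact
  have "\<exists>e\<in>cubic_exponents. ?a e \<noteq> 0"
  proof (rule ccontr)
    assume "\<not> ?thesis"
    then have "?a = (\<lambda>_. 0)" by (auto simp: vec_of_coeffs_def fun_eq_iff)
    then have "coeffs_of ?a i j k = 0" for i j k by (simp only: coeffs_of_def)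
    then show False using d1 by (simp add: d1_def)
  qed
  then obtain e where e: "e \<in> cubic_exponents" "?a e \<noteq> 0" by blast
  let ?L = "point cubic_exponents ?a" and ?M = "point UNIV (chart_point y)"
  have eq: "from_chart L = (?L, ?M)" by (rule from_chart_eq[OF assms(1) y(1)])
  have lines: "?L \<in> lines cubic_exponents" "?M \<in> lines UNIV"
    using e y(2) by (auto intro: point_in_lines[of _ e] point_in_lines[of _ 0])
  have coords: "?a \<in> line_coords ?L" "chart_point y \<in> line_coords ?M"
    using e y(2) by (auto intro!: point_coords[of cubic_exponents e] point_coords[of UNIV "0 :: 3"] simp: vec_of_coeffs_def)
  have "(?L, ?M) \<in> flex_locus"
    by (rule flex_locusI[OF lines coords]) (simp_all only: cong chart_coeffs_flex)
  then show ?C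
    unfolding eq by (rule chart_domainI[OF _ coords]) (simp_all add: d1 y(2))
  have z: "z = (\<lambda>i. z 0 * y i)" using assms(3) by (simp add: y_def fun_eq_iff)
  obtain c where c: "c \<noteq> 0" "\<And>h. homog.is_form 4 h \<Longrightarrow> h z = c * h y"
    using proj.is_form_scale[OF assms(1) y(1) assms(2)] by blast
  have "vec_of_coeffs (chart_coeffs z) = (\<lambda>e. c * ?a e)"
    using c(2)[OF is_form_chart_coeffs] by (auto simp: vec_of_coeffs_def fun_eq_iff)
  then show ?A
    using line_coords_scale[OF lines(1) coords(1) c(1)] by (simp add: eq)
  have "chart_point z = (\<lambda>r. z 0 * chart_point y r)"
    using assms(3) by (auto simp: chart_point_def y_def fun_eq_iff)
  then show ?B
    using line_coords_scale[OF lines(2) coords(2) assms(3)] by (simp add: eq)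
qed

lemma to_from_chart:
  assumes "L \<in> chart_range"
  shows "to_chart (from_chart L) = L"
proof -
  have L: "L \<in> lines {..9}" using assms by (simp add: chart_range_def)
  obtain z where z: "z \<in> line_coords L" "z 0 = 1" using chart_range_normalized[OF assms] by blast
  then have z0: "z 0 \<noteq> 0" by simp
  note fc = from_chart_coords[OF L z(1) z0]
  define \<alpha> where "\<alpha> = vec_of_coeffs (chart_coeffs z)"
  define x where "x = chart_point z"
  have w: "case_sum \<alpha> x \<in> pair_coords (from_chart L)"
    using fc(1,2) pair_coords_iff[of _ "fst (from_chart L)" "snd (from_chart L)"]
    by (auto simp: \<alpha>_def x_def)
  have a: "coeffs_of \<alpha> i j k = chart_coeffs z i j k" if "i + j + k = 3" for i j k
    using that by (simp add: \<alpha>_def)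
  have cong: "d1 (coeffs_of \<alpha>) x = d1 (chart_coeffs z) x" "d2 (coeffs_of \<alpha>) x = d2 (chart_coeffs z) x"
    "d11 (coeffs_of \<alpha>) x = d11 (chart_coeffs z) x" "d12 (coeffs_of \<alpha>) x = d12 (chart_coeffs z) x"
    by (rule cubic_coeffs_cong; rule a; assumption)+
  note d = chart_coeffs_derivs[of z, OF z(2), folded x_def]
  have n: "x 0 = 1" "d1 (coeffs_of \<alpha>) x = 1"
    using z(2) cong d by (simp_all add: x_def)
  have top: "coeffs_of \<alpha> 0 3 0 = z 6" "coeffs_of \<alpha> 0 2 1 = z 7" "coeffs_of \<alpha> 0 1 2 = z 8" "coeffs_of \<alpha> 0 0 3 = z 9"
    by ((subst a, simp), rule d)+
  have x: "x 1 = z 1" "x 2 = z 2" by (simp_all add: x_def)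
  note params = chart_params_normalized[OF n, unfolded cong d top x]
  have *: "chart_params j (case_sum \<alpha> x) = z j" if "j \<in> {..9}" for j
  proof -
    have "j \<in> {0, 1, 2, 3, 4, 5, 6, 7, 8, 9}" using that by auto
    then show ?thesis
      by (elim insertE emptyE; hypsubst) (simp_all only: params z(2), simp_all)
  qed
  have "to_chart (from_chart L) = point {..9} z"
  proof -
    have "from_chart L \<in> flex_locus" using fc(3) by (simp add: chart_domain_def)
    from to_chart_eq[OF this w] point_cong[OF *] show ?thesis
      by (rule trans)
  qed
  then show ?thesis using line_eq_point[OF _ L z(1)] by simp
qed


section \<open>Rationality\<close>

lemma openin_chart_domain: "openin (zariski flex_variety) chart_domain"
proof -
  have "bihomog.is_form (1, 3) (\<lambda>w. w (Inr 0) * d1 (coeffs_of (\<lambda>e. w (Inl e))) (\<lambda>i. w (Inr i)))"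
    by (rule bihomog.is_form_mult[OF is_form_var_x is_form_d1]) simp
  then obtain P where P: "P \<in> bihomog.forms (1, 3)"
    "\<And>w. w (Inr 0) * d1 (coeffs_of (\<lambda>e. w (Inl e))) (\<lambda>i. w (Inr i)) = eval_poly w P"
    by (auto simp: bihomog.is_form_def)
  have "chart_domain = biproj.principal cubic_exponents UNIV P \<inter> flex_locus"
    using flex_locus_lines
    by (auto simp: chart_domain_def biproj.principal_def P(2)[symmetric])
  then show ?thesis
    using biproj.openin_principal[OF P(1)]
    by (auto simp: flex_variety_def PU_times_PV_eq openin_subtopology)
qed

lemma openin_chart_range: "openin (zariski (projective_space 9)) chart_range"
proof -
  have "homog.is_form 1 (\<lambda>z. z (0::nat))"
    by (rule homog.is_form_var) simp
  then obtain P where P: "P \<in> homog.forms 1" "\<And>z. z (0::nat) = eval_poly z P"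
    by (auto simp: homog.is_form_def)
  have "chart_range = proj.principal {..9} P"
    by (auto simp: chart_range_def proj.principal_def P(2)[symmetric])
  then show ?thesis
    using proj.openin_principal[OF P(1), of "{..9}"] by (simp add: projective_space_def projectivization_eq)
qed

lemma chart_range_nonempty: "chart_range \<noteq> {}"
proof -
  define h :: "nat \<Rightarrow> complex" where "h i = (if i = 0 then 1 else 0)" for i
  have L: "point {..9} h \<in> lines {..9}" "h \<in> line_coords (point {..9} h)"
    by (auto intro!: point_in_lines[of _ 0] point_coords[of _ 0] simp: h_def split: if_splits)
  have "z 0 \<noteq> 0" if "z \<in> line_coords (point {..9} h)" for z
    using that line_coords_iff[OF L] by (auto simp: h_def)
  then show ?thesis using L by (auto simp: chart_range_def)
qed

text \<open>Forms of degree \<open>n\<close> are pulled back to forms of bidegree \<open>(2 n, 5 n)\<close>.\<close>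

lemma morphism_to_chart: "morphism (subspace_on flex_variety chart_domain) (projective_space 9) to_chart"
proof -
  have sub: "chart_domain \<subseteq> flex_locus" by (auto simp: chart_domain_def)
  then have "flex_locus \<inter> chart_domain = chart_domain" by blast
  then have "subspace_on flex_variety chart_domain = subspace_on (biproj.cspace cubic_exponents UNIV) chart_domain"
    by (simp add: flex_variety_def PU_times_PV_eq biproj.subspace_on_subspace_on)
  moreover have "morphism (subspace_on (biproj.cspace cubic_exponents UNIV) chart_domain) (proj.cspace {..9}) to_chart"
  proof (rule biproj.morphism_by_forms[where \<psi> = "\<lambda>n. (2 * n, 5 * n)" and h = chart_params])
    show "coordinates mono_degree (lines {..9}) line_coords" by (rule proj.coordinates_axioms)
    show "chart_domain \<subseteq> lines cubic_exponents \<times> lines UNIV"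
      using sub flex_locus_lines by auto
    show "to_chart ` chart_domain \<subseteq> lines {..9}"
      using to_chart_in_range by (auto simp: chart_range_def)
    show "bihomog.is_form (2 * mono_degree (single j 1), 5 * mono_degree (single j 1)) (chart_params j)" for j :: nat
      using is_form_chart_params by simp
    show "(\<lambda>j. chart_params j v) \<in> line_coords (to_chart a)" if "a \<in> chart_domain" "v \<in> pair_coords a" for a v
      using to_chart_in_lines[OF that] by blast
  qed (auto simp: zero_prod_def)
  ultimately show ?thesis by (simp add: projective_space_def projectivization_eq)
qed

text \<open>Forms of bidegree \<open>(d, e)\<close> are pulled back to forms of degree \<open>4 d + e\<close>.\<close>

lemma morphism_from_chart: "morphism (subspace_on (projective_space 9) chart_range) flex_variety from_chart"
proof -
  define h where "h = case_sum (\<lambda>e z. vec_of_coeffs (chart_coeffs z) e) (\<lambda>r z. chart_point z r)"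
  have fc: "from_chart L \<in> chart_domain" "(\<lambda>j. h j z) \<in> pair_coords (from_chart L)"
    if L: "L \<in> chart_range" and z: "z \<in> line_coords L" for L z
  proof -
    have "L \<in> lines {..9}" "z 0 \<noteq> 0" using L z by (auto simp: chart_range_def)
    note fc = from_chart_coords[OF this(1) z this(2)]
    show "from_chart L \<in> chart_domain" by (rule fc)
    have "(\<lambda>j. h j z) = case_sum (vec_of_coeffs (chart_coeffs z)) (chart_point z)"
      by (auto simp: h_def fun_eq_iff split: sum.splits)
    then show "(\<lambda>j. h j z) \<in> pair_coords (from_chart L)"
      using fc(1,2) pair_coords_iff[of _ "fst (from_chart L)" "snd (from_chart L)"] by auto
  qed
  have dom: "from_chart L \<in> chart_domain" if "L \<in> chart_range" for L
    using fc(1)[OF that] chart_range_normalized[OF that] by blast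
  have sub: "chart_range \<subseteq> lines {..9}" by (auto simp: chart_range_def)
  have z: "homog.is_form 1 (\<lambda>z. z i)" for i :: nat
    by (rule homog.is_form_var) simp
  have "homog.is_form ((\<lambda>(d, e). 4 * d + e) (mono_bidegree (single j 1))) (h j)" for j
  proof (cases j)
    case (Inl e)
    then show ?thesis
      by (simp add: h_def vec_of_coeffs_def homog.is_form_if is_form_chart_coeffs homog.is_form_0)
  next
    case (Inr r)
    then show ?thesis
      using z by (simp add: h_def chart_point_def homog.is_form_if)
  qed
  then have "morphism (subspace_on (proj.cspace {..9}) chart_range) (biproj.cspace cubic_exponents UNIV) from_chart"
    using sub dom fc(2) flex_locus_subset
    by (intro proj.morphism_by_forms[where \<psi> = "\<lambda>(d, e). 4 * d + e" and h = h] biproj.coordinates_axioms)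
       (force simp: zero_prod_def chart_domain_def)+
  then have "morphism (subspace_on (proj.cspace {..9}) chart_range)
      (subspace_on (biproj.cspace cubic_exponents UNIV) flex_locus) from_chart"
    using dom sub by (intro proj.morphism_into_subspace) (auto simp: chart_domain_def)
  then show ?thesis
    by (simp add: projective_space_def projectivization_eq flex_variety_def PU_times_PV_eq)
qed

theorem theorem3:
  shows "rational_variety flex_variety"
proof -
  have from_dom: "from_chart L \<in> chart_domain" if "L \<in> chart_range" for L
    using from_chart_coords(3)[of L] chart_range_normalized[OF that] that
    by (auto simp: chart_range_def)
  have dom_nonempty: "chart_domain \<noteq> {}"
    using chart_range_nonempty from_dom by blast
  have to_image: "to_chart ` chart_domain = chart_range"
    using to_chart_in_range to_from_chart from_dom by (auto simp: image_iff) metis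
  have from_image: "from_chart ` chart_range = chart_domain"
    using to_chart_in_range from_to_chart from_dom by (auto simp: image_iff) metis
  have "points flex_variety \<noteq> {}"
    using dom_nonempty openin_subset[OF openin_chart_domain] by blast
  then have "irreducible_variety flex_variety"
    by (intro hyperconnected_imp_irreducible hyperconnected_flex_variety)
  moreover have "dominant_rational_map flex_variety (projective_space 9) chart_domain to_chart"
    unfolding dominant_rational_map_def to_image
    by (intro conjI openin_chart_domain dom_nonempty morphism_to_chart hyperconnected_dense
        hyperconnected_projective_space openin_chart_range chart_range_nonempty)
  moreover have "dominant_rational_map (projective_space 9) flex_variety chart_range from_chart"
    unfolding dominant_rational_map_def from_image
    by (intro conjI openin_chart_domain dom_nonempty morphism_from_chart hyperconnected_dense
        hyperconnected_flex_variety openin_chart_range chart_range_nonempty)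
  moreover have "\<forall>a\<in>chart_domain. a \<in> chart_domain \<and> to_chart a \<in> chart_range \<and> from_chart (to_chart a) = a"
    using to_chart_in_range from_to_chart by blast
  moreover have "\<forall>L\<in>chart_range. L \<in> chart_range \<and> from_chart L \<in> chart_domain \<and> to_chart (from_chart L) = L"
    using from_dom to_from_chart by blast
  ultimately have "birationally_isomorphic flex_variety (projective_space 9)"
    unfolding birationally_isomorphic_def
    using openin_chart_domain dom_nonempty openin_chart_range chart_range_nonempty by blast
  then show ?thesis
    using \<open>irreducible_variety flex_variety\<close> by (auto simp: rational_variety_def)
qed

end
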